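(* Let $G$ be a countable sofic group acting continuously on a compact metrizable space $X$. Suppose that the action has the small-boundary property. Let $\Sigma$ be a sofic approximation sequence for $G$. Then $\mathrm{mdim}_\Sigma(X)\le0$.
   Context: Small-boundary property. Let $M(X,G)$ be the set of $G$-invariant Borel probability measures on $X$. A closed subset $Z\subseteq X$ is small if $\mu(Z)=0$ for all $\mu\in M(X,G)$ (so if $M(X,G)$ is empty, every closed subset is small). The action has the small-boundary property if for every $x\in X$ and every neighborhood $U$ of $x$ there is an open neighborhood $V\subseteq U$ of $x$ whose boundary is small. Sofic approximations. For $d\in\mathbb N$ write $[d]=\{1,\dots,d\}$ and $\mathrm{Sym}(d)$ for the permutation group of $[d]$. A sofic approximation sequence for a countable group $G$ is a sequence of maps $\Sigma=\{\sigma_i:G\to\mathrm{Sym}(d_i)\}_{i=1}^\infty$ such that: (1) for all $s,t\in G$, $\lim_i |\{a\in[d_i]:\sigma_i(s)\sigma_i(t)(a)=\sigma_i(st)(a)\}|/d_i=1$; (2) for all distinct $s,t\in G$, $\lim_i|\{a\in[d_i]:\sigma_i(s)(a)=\sigma_i(t)(a)\}|/d_i=0$; (3) $\lim_i d_i=+\infty$. $G$ is sofic if it has such a sequence. We write $\sigma_s=\sigma(s)$. Order and $\mathcal D$. For finite open covers of a compact space $Y$, $\mathcal V\succ\mathcal U$ means every element of $\mathcal V$ is contained in some element of $\mathcal U$. Put $\mathrm{ord}(\mathcal U)=\max_{y\in Y}\sum_{U\in\mathcal U}1_U(y)-1$ and $\mathcal D(\mathcal U)=\min_{\mathcal V\succ\mathcal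 U}\mathrm{ord}(\mathcal V)$, the minimum over finite open covers $\mathcal V$ of $Y$ refining $\mathcal U$. Sofic mean topological dimension. Let $G$ act continuously on a compact metrizable space $X$ by $\alpha$, and let $\rho$ be a compatible metric on $X$. For maps $\varphi,\psi:[d]\to X$ put $\rho_2(\varphi,\psi)=\big(\frac1d\sum_{a\in[d]}\rho(\varphi(a),\psi(a))^2\big)^{1/2}$. For a nonempty finite $F\subseteq G$, $\delta>0$, and a map $\sigma:G\to\mathrm{Sym}(d)$, $\mathrm{Map}(\rho,F,\delta,\sigma)$ is the set of all $\varphi:[d]\to X$ with $\rho_2(\varphi\circ\sigma_s,\alpha_s\circ\varphi)\le\delta$ for all $s\in F$, a closed subspace of $X^{[d]}$. For a finite open cover $\mathcal U$ of $X$, $\mathcal U^d$ is the open cover of $X^{[d]}$ by the sets $U_1\times\cdots\times U_d$, $U_j\in\mathcal U$. Let $\mathcal D(\mathcal U,\rho,F,\delta,\sigma)=\mathcal D(\mathcal U^d|_{\mathrm{Map}(\rho,F,\delta,\sigma)})$, where $|$ denotes the restricted cover. Put $\mathcal D_\Sigma(\mathcal U,\rho,F,\delta)=\varlimsup_{i\to\infty}\mathcal D(\mathcal U,\rho,F,\delta,\sigma_i)/d_i$, set to $-\infty$ if $\mathrm{Map}(\rho,F,\delta,\sigma_i)$ is empty for all sufficiently large $i$; $\mathcal D_\Sigma(\mathcal U)=\inf_F\inf_{\delta>0}\mathcal D_\Sigma(\mathcal U,\rho,F,\delta)$ over nonempty finite $F\subseteq G$ and $\delta>0$ (this does not depend on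 the choice of $\rho$); and $\mathrm{mdim}_\Sigma(X)=\sup_{\mathcal U}\mathcal D_\Sigma(\mathcal U)$ over finite open covers $\mathcal U$ of $X$. *)

theory Defs
  imports
    "HOL-Analysis.Analysis"
    "HOL-Probability.Probability"
    "HOL-Algebra.Group_Action"
    "HOL-Combinatorics.Permutations"
begin

definition continuous_action ::
  "('g, 'm) monoid_scheme \<Rightarrow> 'x topology \<Rightarrow> ('g \<Rightarrow> 'x \<Rightarrow> 'x) \<Rightarrow> bool" where
  "continuous_action G X \<alpha> \<longleftrightarrow>
     group_action G (topspace X) \<alpha> \<and> (\<forall>g\<in>carrier G. continuous_map X X (\<alpha> g))"

definition compatible_metric :: "'x topology \<Rightarrow> ('x \<Rightarrow> 'x \<Rightarrow> real) \<Rightarrow> bool" where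
  "compatible_metric X \<rho> \<longleftrightarrow>
     Metric_space (topspace X) \<rho> \<and> Metric_space.mtopology (topspace X) \<rho> = X"

definition borel_of :: "'x topology \<Rightarrow> 'x measure" where
  "borel_of X = sigma (topspace X) {U. openin X U}"

definition invariant_measures ::
  "('g, 'm) monoid_scheme \<Rightarrow> 'x topology \<Rightarrow> ('g \<Rightarrow> 'x \<Rightarrow> 'x) \<Rightarrow> 'x measure set" where
  "invariant_measures G X \<alpha> =
     {\<mu>. prob_space \<mu> \<and> sets \<mu> = sets (borel_of X) \<and>
          (\<forall>g\<in>carrier G. distr \<mu> (borel_of X) (\<alpha> g) = \<mu>)}"

definition small_set ::
  "('g, 'm) monoid_scheme \<Rightarrow> 'x topology \<Rightarrow> ('g \<Rightarrow> 'x \<Rightarrow> 'x) \<Rightarrow> 'x set \<Rightarrow> bool" where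
  "small_set G X \<alpha> Z \<longleftrightarrow>
     closedin X Z \<and> (\<forall>\<mu>\<in>invariant_measures G X \<alpha>. emeasure \<mu> Z = 0)"

definition small_boundary_property ::
  "('g, 'm) monoid_scheme \<Rightarrow> 'x topology \<Rightarrow> ('g \<Rightarrow> 'x \<Rightarrow> 'x) \<Rightarrow> bool" where
  "small_boundary_property G X \<alpha> \<longleftrightarrow>
     (\<forall>x\<in>topspace X. \<forall>U\<subseteq>topspace X. x \<in> X interior_of U \<longrightarrow>
        (\<exists>V. openin X V \<and> x \<in> V \<and> V \<subseteq> U \<and> small_set G X \<alpha> (X frontier_of V)))"

text \<open>The sequence of maps into the permutation groups of \<open>{1..d i}\<close> is indexed from \<open>i = 0\<close>.\<close>

definition sofic_approximation ::
  "('g, 'm) monoid_scheme \<Rightarrow> (nat \<Rightarrow> nat) \<Rightarrow> (nat \<Rightarrow> 'g \<Rightarrow> nat \<Rightarrow> nat) \<Rightarrow> bool" where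
  "sofic_approximation G d \<sigma> \<longleftrightarrow>
     (\<forall>i. \<forall>s\<in>carrier G. \<sigma> i s permutes {1..d i}) \<and>
     (\<forall>s\<in>carrier G. \<forall>t\<in>carrier G.
        (\<lambda>i. real (card {a\<in>{1..d i}. \<sigma> i s (\<sigma> i t a) = \<sigma> i (s \<otimes>\<^bsub>G\<^esub> t) a}) / real (d i))
          \<longlonglongrightarrow> 1) \<and>
     (\<forall>s\<in>carrier G. \<forall>t\<in>carrier G. s \<noteq> t \<longrightarrow>
        (\<lambda>i. real (card {a\<in>{1..d i}. \<sigma> i s a = \<sigma> i t a}) / real (d i)) \<longlonglongrightarrow> 0) \<and>
     filterlim d at_top sequentially"

definition sofic_group :: "('g, 'm) monoid_scheme \<Rightarrow> bool" where
  "sofic_group G \<longleftrightarrow> group G \<and> countable (carrier G) \<and> (\<exists>d \<sigma>. sofic_approximation G d \<sigma>)"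

definition finite_open_cover :: "'y topology \<Rightarrow> 'y set set \<Rightarrow> bool" where
  "finite_open_cover Y \<U> \<longleftrightarrow> finite \<U> \<and> (\<forall>U\<in>\<U>. openin Y U) \<and> \<Union>\<U> = topspace Y"

definition refines :: "'y set set \<Rightarrow> 'y set set \<Rightarrow> bool" where
  "refines \<V> \<U> \<longleftrightarrow> (\<forall>V\<in>\<V>. \<exists>U\<in>\<U>. V \<subseteq> U)"

text \<open>For a finite cover the supremum in \<open>nat\<close> is a maximum; on the empty space it is \<open>0\<close>,
  so that the order is \<open>-1\<close> there.\<close>

definition cover_order :: "'y topology \<Rightarrow> 'y set set \<Rightarrow> int" where
  "cover_order Y \<U> = int (SUP y\<in>topspace Y. card {U\<in>\<U>. y \<in> U}) - 1"

text \<open>The infimum is over a set of integers bounded below by \<open>-1\<close>, which is nonempty since a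
  finite open cover refines itself; hence it is a minimum.\<close>

definition cover_dim :: "'y topology \<Rightarrow> 'y set set \<Rightarrow> int" where
  "cover_dim Y \<U> = Inf {cover_order Y \<V> |\<V>. finite_open_cover Y \<V> \<and> refines \<V> \<U>}"

definition dist2 ::
  "('x \<Rightarrow> 'x \<Rightarrow> real) \<Rightarrow> nat \<Rightarrow> (nat \<Rightarrow> 'x) \<Rightarrow> (nat \<Rightarrow> 'x) \<Rightarrow> real" where
  "dist2 \<rho> d \<phi> \<psi> = sqrt (1 / real d * (\<Sum>a\<in>{1..d}. (\<rho> (\<phi> a) (\<psi> a))\<^sup>2))"

definition approx_maps ::
  "'x topology \<Rightarrow> ('g \<Rightarrow> 'x \<Rightarrow> 'x) \<Rightarrow> ('x \<Rightarrow> 'x \<Rightarrow> real) \<Rightarrow> 'g set \<Rightarrow> real \<Rightarrow>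
   nat \<Rightarrow> ('g \<Rightarrow> nat \<Rightarrow> nat) \<Rightarrow> (nat \<Rightarrow> 'x) set" where
  "approx_maps X \<alpha> \<rho> F \<delta> d \<sigma> =
     {\<phi> \<in> {1..d} \<rightarrow>\<^sub>E topspace X. \<forall>s\<in>F. dist2 \<rho> d (\<phi> \<circ> \<sigma> s) (\<alpha> s \<circ> \<phi>) \<le> \<delta>}"

definition power_cover :: "nat \<Rightarrow> 'x set set \<Rightarrow> (nat \<Rightarrow> 'x) set set" where
  "power_cover d \<U> = {\<Pi>\<^sub>E j\<in>{1..d}. U j |U. \<forall>j\<in>{1..d}. U j \<in> \<U>}"

definition restrict_cover :: "'y set set \<Rightarrow> 'y set \<Rightarrow> 'y set set" where
  "restrict_cover \<W> S = (\<lambda>W. W \<inter> S) ` \<W>"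

definition approx_dim ::
  "'x topology \<Rightarrow> ('g \<Rightarrow> 'x \<Rightarrow> 'x) \<Rightarrow> 'x set set \<Rightarrow> ('x \<Rightarrow> 'x \<Rightarrow> real) \<Rightarrow> 'g set \<Rightarrow> real \<Rightarrow>
   nat \<Rightarrow> ('g \<Rightarrow> nat \<Rightarrow> nat) \<Rightarrow> int" where
  "approx_dim X \<alpha> \<U> \<rho> F \<delta> d \<sigma> =
     cover_dim
       (subtopology (product_topology (\<lambda>_. X) {1..d}) (approx_maps X \<alpha> \<rho> F \<delta> d \<sigma>))
       (restrict_cover (power_cover d \<U>) (approx_maps X \<alpha> \<rho> F \<delta> d \<sigma>))"

definition sofic_dim_at ::
  "'x topology \<Rightarrow> ('g \<Rightarrow> 'x \<Rightarrow> 'x) \<Rightarrow> (nat \<Rightarrow> nat) \<Rightarrow> (nat \<Rightarrow> 'g \<Rightarrow> nat \<Rightarrow> nat) \<Rightarrow>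
   'x set set \<Rightarrow> ('x \<Rightarrow> 'x \<Rightarrow> real) \<Rightarrow> 'g set \<Rightarrow> real \<Rightarrow> ereal" where
  "sofic_dim_at X \<alpha> d \<sigma> \<U> \<rho> F \<delta> =
     (if \<forall>\<^sub>F i in sequentially. approx_maps X \<alpha> \<rho> F \<delta> (d i) (\<sigma> i) = {} then - \<infinity>
      else limsup (\<lambda>i. ereal (real_of_int (approx_dim X \<alpha> \<U> \<rho> F \<delta> (d i) (\<sigma> i)) / real (d i))))"

definition sofic_dim ::
  "('g, 'm) monoid_scheme \<Rightarrow> 'x topology \<Rightarrow> ('g \<Rightarrow> 'x \<Rightarrow> 'x) \<Rightarrow> (nat \<Rightarrow> nat) \<Rightarrow>
   (nat \<Rightarrow> 'g \<Rightarrow> nat \<Rightarrow> nat) \<Rightarrow> ('x \<Rightarrow> 'x \<Rightarrow> real) \<Rightarrow> 'x set set \<Rightarrow> ereal" where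
  "sofic_dim G X \<alpha> d \<sigma> \<rho> \<U> =
     (INF F\<in>{F. finite F \<and> F \<noteq> {} \<and> F \<subseteq> carrier G}. INF \<delta>\<in>{0<..}. sofic_dim_at X \<alpha> d \<sigma> \<U> \<rho> F \<delta>)"

text \<open>The value does not depend on the compatible metric \<open>\<rho>\<close>, which is kept as a parameter.\<close>

definition sofic_mdim ::
  "('g, 'm) monoid_scheme \<Rightarrow> 'x topology \<Rightarrow> ('g \<Rightarrow> 'x \<Rightarrow> 'x) \<Rightarrow> (nat \<Rightarrow> nat) \<Rightarrow>
   (nat \<Rightarrow> 'g \<Rightarrow> nat \<Rightarrow> nat) \<Rightarrow> ('x \<Rightarrow> 'x \<Rightarrow> real) \<Rightarrow> ereal" where
  "sofic_mdim G X \<alpha> d \<sigma> \<rho> = (SUP \<U>\<in>{\<U>. finite_open_cover X \<U>}. sofic_dim G X \<alpha> d \<sigma> \<rho> \<U>)"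

end

theory Submission
  imports Defs
begin

text \<open>
  Let \<open>\<V>\<close> be a finite cover by open sets with small boundary refining \<open>\<U>\<close>. Choose continuous
  functions \<open>w V : X \<rightarrow> [0,1]\<close> with \<open>w V = 0\<close> off \<open>V\<close>, with \<open>max\<^sub>V w V = 1\<close> everywhere, and taking
  values in \<open>{0,1}\<close> outside a thin neighbourhood of the boundaries. For \<open>\<phi> \<in> X\<^sup>d\<close> and a threshold
  \<open>0 < t < 1\<close> consider the set of pairs \<open>(a, V)\<close> with \<open>w V (\<phi> a) > t\<close>. The \<open>\<phi>\<close> for which a given set
  of pairs occurs, at a threshold attained by no \<open>w V (\<phi> a)\<close>, form an open set, and these open sets
  refine \<open>\<U>\<^sup>d\<close>. As \<open>t\<close> varies, the sets of pairs belonging to one \<open>\<phi>\<close> form a chain, so at most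
  \<open>1 + |{(a, V). 0 < w V (\<phi> a) < 1}|\<close> of them occur; this bounds the order of the cover by
  \<open>|\<V>|\<close> times the number of \<open>a\<close> for which \<open>\<phi> a\<close> is close to a boundary.

  If this number were at least \<open>\<epsilon> d\<close> for approximately equivariant \<open>\<phi>\<close> of increasing quality, then a
  weak limit of the empirical measures of the \<open>\<phi>\<close> would be an invariant measure charging a boundary.
  To get weak limits without a representation theorem, \<open>X\<close> is written as a continuous image of a
  compact set of reals, where Helly's selection theorem applies.
\<close>

section \<open>Covers from threshold sets\<close>

text \<open>Distinct members of a chain of finite sets have distinct cardinalities. All members
  contain \<open>A\<close>, so they are told apart by \<open>card (S - A)\<close>, which takes at
  most \<open>1 + card (B - A)\<close> values.\<close>

lemma chain_interval_card_le:
  assumes "finite B" and sub: "\<And>S. S \<in> \<S> \<Longrightarrow> A \<subseteq> S \<and> S \<subseteq> B"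
    and chain: "\<And>S T. S \<in> \<S> \<Longrightarrow> T \<in> \<S> \<Longrightarrow> S \<subseteq> T \<or> T \<subseteq> S"
  shows "card \<S> \<le> 1 + card (B - A)"
proof -
  have fin: "finite S" if "S \<in> \<S>" for S
    using sub[OF that] \<open>finite B\<close> finite_subset by blast
  have "inj_on (\<lambda>S. card (S - A)) \<S>"
  proof (rule inj_onI)
    fix S T assume ST: "S \<in> \<S>" "T \<in> \<S>" "card (S - A) = card (T - A)"
    have "S - A = T - A"
      using chain[OF ST(1,2)] ST fin by (metis Diff_mono card_subset_eq finite_Diff subset_refl)
    then show "S = T"
      using sub ST by blast
  qed
  moreover have "(\<lambda>S. card (S - A)) ` \<S> \<subseteq> {..card (B - A)}"
    using sub \<open>finite B\<close> by (auto intro!: card_mono)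
  ultimately have "card \<S> \<le> card {..card (B - A)}"
    by (intro card_inj_on_le[where f = "\<lambda>S. card (S - A)"]) auto
  then show ?thesis by simp
qed

text \<open>The set \<open>S\<close> is the superlevel set of \<open>i \<mapsto> q i y\<close> at a
  threshold \<open>t\<close> that no value attains. Strictness on both sides is what makes the
  condition open; the threshold may vary with \<open>y\<close>.\<close>

definition level_set :: "'y topology \<Rightarrow> 'i set \<Rightarrow> ('i \<Rightarrow> 'y \<Rightarrow> real) \<Rightarrow> 'i set \<Rightarrow> 'y set" where
  "level_set Y I q S =
     {y \<in> topspace Y. \<exists>t. 0 < t \<and> t < 1 \<and> (\<forall>i\<in>S. t < q i y) \<and> (\<forall>i\<in>I - S. q i y < t)}"

lemma openin_level_set:
  assumes "finite I" "S \<subseteq> I" and cont: "\<And>i. i \<in> I \<Longrightarrow> continuous_map Y euclideanreal (q i)"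
  shows "openin Y (level_set Y I q S)"
proof -
  have 1: "openin Y {y \<in> topspace Y. t < q i y}" if "i \<in> I" for i t
    using openin_continuous_map_preimage[OF cont[OF that], of "{t<..}"] by simp
  have 2: "openin Y {y \<in> topspace Y. q i y < t}" if "i \<in> I" for i t
    using openin_continuous_map_preimage[OF cont[OF that], of "{..<t}"] by simp
  have fin: "finite S" "finite (I - S)"
    using assms finite_subset by auto
  \<comment> \<open>Intersecting with \<open>topspace Y\<close> covers the case of an empty index
    set, where the bare intersection would be \<open>UNIV\<close>.\<close>
  have "openin Y (((\<Inter>i\<in>S. {y \<in> topspace Y. t < q i y}) \<inter> topspace Y) \<inter>
      ((\<Inter>i\<in>I - S. {y \<in> topspace Y. q i y < t}) \<inter> topspace Y))" for t
    using fin \<open>S \<subseteq> I\<close> 1 2 by (intro openin_Int openin_INT) auto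
  moreover have "level_set Y I q S = (\<Union>t\<in>{0<..<1}.
      (((\<Inter>i\<in>S. {y \<in> topspace Y. t < q i y}) \<inter> topspace Y) \<inter>
      ((\<Inter>i\<in>I - S. {y \<in> topspace Y. q i y < t}) \<inter> topspace Y)))"
    unfolding level_set_def by auto
  ultimately show ?thesis
    by (metis (no_types, lifting) imageE openin_Union)
qed

text \<open>The finitely many values \<open>q i y\<close> cannot exhaust the infinite interval
  (0,1), so an unattained threshold exists, and its superlevel set serves as
  \<open>S\<close>.\<close>

lemma level_sets_cover:
  assumes "finite I" "y \<in> topspace Y"
  shows "\<exists>S\<subseteq>I. y \<in> level_set Y I q S"
proof -
  have "infinite {0<..<1::real}"
    by (simp add: infinite_Ioo)
  then have "\<not> {0<..<1} \<subseteq> (\<lambda>i. q i y) ` I"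
    using finite_subset[OF _ finite_imageI[OF assms(1), of "\<lambda>i. q i y"]] by metis
  then obtain t where "t \<in> {0<..<1}" "t \<notin> (\<lambda>i. q i y) ` I"
    by blast
  then have t: "0 < t" "t < 1" "t \<notin> (\<lambda>i. q i y) ` I"
    by auto
  have "q i y < t" if "i \<in> I - {i \<in> I. t < q i y}" for i
  proof -
    have "\<not> t < q i y" "t \<noteq> q i y"
      using that t(3) by blast+
    then show ?thesis by linarith
  qed
  then have "y \<in> level_set Y I q {i \<in> I. t < q i y}"
    using assms(2) t(1,2) unfolding level_set_def by (intro CollectI conjI exI[of _ t]) auto
  then show ?thesis
    by (intro exI[of _ "{i \<in> I. t < q i y}"]) auto
qed

text \<open>The sets \<open>S\<close> with \<open>y \<in> level_set Y I q S\<close> are superlevel sets of \<open>i \<mapsto> q i y\<close>, so they form a chain.\<close>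

lemma level_set_multiplicity:
  assumes "finite I" and range: "\<And>i. i \<in> I \<Longrightarrow> q i y \<le> 1"
  shows "card {S. S \<subseteq> I \<and> y \<in> level_set Y I q S} \<le> 1 + card {i \<in> I. 0 < q i y \<and> q i y < 1}"
proof -
  \<comment> \<open>Thresholds lie strictly between 0 and 1, so each such \<open>S\<close> is
    squeezed between the indices of value 1 and those of positive value.\<close>
  have "card {S. S \<subseteq> I \<and> y \<in> level_set Y I q S}
      \<le> 1 + card ({i \<in> I. 0 < q i y} - {i \<in> I. q i y = 1})"
  proof (rule chain_interval_card_le)
    show "{i \<in> I. q i y = 1} \<subseteq> S \<and> S \<subseteq> {i \<in> I. 0 < q i y}"
      if S: "S \<in> {S. S \<subseteq> I \<and> y \<in> level_set Y I q S}" for S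
    proof -
      obtain t where t: "0 < t" "t < 1" "\<forall>i\<in>S. t < q i y" "\<forall>i\<in>I - S. q i y < t"
        using S unfolding level_set_def by blast
      have "i \<in> S" if "i \<in> I" "q i y = 1" for i
        using t that by (metis DiffI less_asym)
      moreover have "0 < q i y" if "i \<in> S" for i
        using t that by (meson less_trans)
      ultimately show ?thesis
        using S by blast
    qed
    fix S T assume S: "S \<in> {S. S \<subseteq> I \<and> y \<in> level_set Y I q S}"
      and T: "T \<in> {S. S \<subseteq> I \<and> y \<in> level_set Y I q S}"
    \<comment> \<open>Superlevel sets decrease as the threshold grows: a set cut at \<open>a\<close>
      lies in a set cut at any \<open>b \<le> a\<close>.\<close>
    have sub: "A \<subseteq> B" if "A \<subseteq> I" "\<forall>i\<in>A. a < q i y" "\<forall>i\<in>I - B. q i y < b" "b \<le> a" for A B a b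
    proof
      fix i assume "i \<in> A"
      then show "i \<in> B"
        using that by (cases "i \<in> B") (force dest: bspec)+
    qed
    obtain s t where "\<forall>i\<in>S. s < q i y" "\<forall>i\<in>I - S. q i y < s" "\<forall>i\<in>T. t < q i y" "\<forall>i\<in>I - T. q i y < t"
      using S T unfolding level_set_def by blast
    then show "S \<subseteq> T \<or> T \<subseteq> S"
      using sub[of S s T t] sub[of T t S s] S T by force
  qed (use \<open>finite I\<close> in auto)
  also have "{i \<in> I. 0 < q i y} - {i \<in> I. q i y = 1} = {i \<in> I. 0 < q i y \<and> q i y < 1}"
    using range order.order_iff_strict by fastforce
  finally show ?thesis .
qed

section \<open>Bounding the dimension by the number of intermediate values\<close>

lemma cover_dim_le_order:
  assumes "finite_open_cover Y \<V>" "refines \<V> \<U>"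
  shows "cover_dim Y \<U> \<le> cover_order Y \<V>"
  unfolding cover_dim_def
proof (rule cInf_lower)
  show "bdd_below {cover_order Y \<V> |\<V>. finite_open_cover Y \<V> \<and> refines \<V> \<U>}"
    by (rule bdd_belowI[of _ "-1"]) (auto simp: cover_order_def)
qed (use assms in auto)

text \<open>The nonempty level sets form the refining cover. At most \<open>1 + N\<close> of them
  meet at a point, and the \<open>- 1\<close> in \<open>cover_order\<close> removes the extra 1.
  Coincidences between level sets of different \<open>S\<close> only lower the multiplicity.\<close>

lemma cover_dim_le_intermediate_count:
  fixes q :: "'i \<Rightarrow> 'y \<Rightarrow> real"
  assumes "finite I" and cont: "\<And>i. i \<in> I \<Longrightarrow> continuous_map Y euclideanreal (q i)"
    and range: "\<And>i y. i \<in> I \<Longrightarrow> y \<in> topspace Y \<Longrightarrow> q i y \<le> 1"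
    and ref: "\<And>S. S \<subseteq> I \<Longrightarrow> level_set Y I q S \<noteq> {} \<Longrightarrow> \<exists>U\<in>\<U>. level_set Y I q S \<subseteq> U"
    and count: "\<And>y. y \<in> topspace Y \<Longrightarrow> card {i \<in> I. 0 < q i y \<and> q i y < 1} \<le> N"
  shows "cover_dim Y \<U> \<le> int N"
proof -
  define \<V> where "\<V> = level_set Y I q ` Pow I - {{}}"
  have "finite_open_cover Y \<V>"
    unfolding finite_open_cover_def
  proof (intro conjI ballI)
    show "finite \<V>" using \<open>finite I\<close> by (simp add: \<V>_def)
    show "openin Y U" if "U \<in> \<V>" for U
      using that openin_level_set[OF \<open>finite I\<close> _ cont] by (auto simp: \<V>_def)
    show "\<Union>\<V> = topspace Y"
    proof
      show "\<Union>\<V> \<subseteq> topspace Y" by (auto simp: \<V>_def level_set_def)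
      show "topspace Y \<subseteq> \<Union>\<V>"
        using level_sets_cover[OF \<open>finite I\<close>, of _ Y q] by (auto simp: \<V>_def) blast
    qed
  qed
  moreover have "refines \<V> \<U>"
    unfolding refines_def \<V>_def using ref by auto
  ultimately have "cover_dim Y \<U> \<le> cover_order Y \<V>"
    by (rule cover_dim_le_order)
  also have "(SUP y\<in>topspace Y. card {U\<in>\<V>. y \<in> U}) \<le> 1 + N"
  proof (cases "topspace Y = {}")
    case True then show ?thesis by simp
  next
    case False
    show ?thesis
    proof (rule cSUP_least[OF False])
      fix y assume y: "y \<in> topspace Y"
      have "{U\<in>\<V>. y \<in> U} \<subseteq> level_set Y I q ` {S. S \<subseteq> I \<and> y \<in> level_set Y I q S}"
        by (auto simp: \<V>_def)
      then have "card {U\<in>\<V>. y \<in> U} \<le> card {S. S \<subseteq> I \<and> y \<in> level_set Y I q S}"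
        using \<open>finite I\<close> by (intro surj_card_le) auto
      also have "\<dots> \<le> 1 + card {i \<in> I. 0 < q i y \<and> q i y < 1}"
        using \<open>finite I\<close> range y by (intro level_set_multiplicity) auto
      also have "\<dots> \<le> 1 + N" using count[OF y] by simp
      finally show "card {U\<in>\<V>. y \<in> U} \<le> 1 + N" .
    qed
  qed
  then have "cover_order Y \<V> \<le> int N" by (simp add: cover_order_def)
  finally show ?thesis .
qed

text \<open>The functions \<open>\<phi> \<mapsto> w V (\<phi> a)\<close>, indexed by pairs
  \<open>(a, V)\<close>, are fed into the previous bound. What needs an argument is that each
  nonempty level set lies in a product of members of \<open>\<U>\<close>.\<close>

lemma approx_dim_le_intermediate_count:
  fixes w :: "'x set \<Rightarrow> 'x \<Rightarrow> real"
  assumes "finite \<V>" "refines \<V> \<U>"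
    and cont: "\<And>V. V \<in> \<V> \<Longrightarrow> continuous_map X euclideanreal (w V)"
    and le1: "\<And>V x. V \<in> \<V> \<Longrightarrow> x \<in> topspace X \<Longrightarrow> w V x \<le> 1"
    and supp: "\<And>V x. V \<in> \<V> \<Longrightarrow> x \<in> topspace X \<Longrightarrow> 0 < w V x \<Longrightarrow> x \<in> V"
    and one: "\<And>x. x \<in> topspace X \<Longrightarrow> \<exists>V\<in>\<V>. w V x = 1"
    and count: "\<And>\<phi>. \<phi> \<in> approx_maps X \<alpha> \<rho> F \<delta> d \<sigma> \<Longrightarrow>
      card {(a, V). a \<in> {1..d} \<and> V \<in> \<V> \<and> 0 < w V (\<phi> a) \<and> w V (\<phi> a) < 1} \<le> N"
  shows "approx_dim X \<alpha> \<U> \<rho> F \<delta> d \<sigma> \<le> int N"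
  unfolding approx_dim_def
proof -
  let ?M = "approx_maps X \<alpha> \<rho> F \<delta> d \<sigma>"
  let ?Y = "subtopology (product_topology (\<lambda>_. X) {1..d}) ?M"
  let ?I = "{1..d} \<times> \<V>"
  let ?q = "\<lambda>(a, V) \<phi>. w V (\<phi> a)"
  have top: "topspace ?Y = ?M"
    by (auto simp: approx_maps_def)
  have inX: "\<phi> a \<in> topspace X" if "\<phi> \<in> ?M" "a \<in> {1..d}" for \<phi> a
    using that by (auto simp: approx_maps_def)
  show "cover_dim ?Y (restrict_cover (power_cover d \<U>) ?M) \<le> int N"
  proof (rule cover_dim_le_intermediate_count[where I = ?I and q = ?q])
    show "finite ?I" using assms by auto
    show "continuous_map ?Y euclideanreal (?q i)" if iI: "i \<in> ?I" for i
    proof -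
      obtain a V where i: "i = (a, V)" "a \<in> {1..d}" "V \<in> \<V>" using iI by blast
      have "continuous_map (product_topology (\<lambda>_. X) {1..d}) X (\<lambda>\<phi>. \<phi> a)"
        using i by (intro continuous_map_product_projection) auto
      then have "continuous_map ?Y X (\<lambda>\<phi>. \<phi> a)"
        by (rule continuous_map_from_subtopology)
      from continuous_map_compose[OF this cont[OF i(3)]] show ?thesis
        by (simp add: i o_def)
    qed
    show "?q i \<phi> \<le> 1" if "i \<in> ?I" "\<phi> \<in> topspace ?Y" for i \<phi>
      using that inX le1 unfolding top by auto
    show "card {i \<in> ?I. 0 < ?q i \<phi> \<and> ?q i \<phi> < 1} \<le> N" if "\<phi> \<in> topspace ?Y" for \<phi>
    proof -
      have "{i \<in> ?I. 0 < ?q i \<phi> \<and> ?q i \<phi> < 1}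
        = {(a, V). a \<in> {1..d} \<and> V \<in> \<V> \<and> 0 < w V (\<phi> a) \<and> w V (\<phi> a) < 1}" by auto
      then show ?thesis using count[of \<phi>] that unfolding top by simp
    qed
    fix S assume S: "S \<subseteq> ?I" and ne: "level_set ?Y ?I ?q S \<noteq> {}"
    \<comment> \<open>Some \<open>V\<close> has weight 1 at \<open>\<phi> a\<close>; as the
      threshold is below 1, the pair \<open>(a, V)\<close> cannot be outside \<open>S\<close>.
      Membership of \<open>(a, V)\<close> in \<open>S\<close> then forces
      \<open>\<phi> a \<in> V\<close> on the whole level set.\<close>
    have "\<exists>V. V \<in> \<V> \<and> (a, V) \<in> S" if a: "a \<in> {1..d}" for a
    proof -
      obtain \<phi> t where \<phi>: "\<phi> \<in> ?M" "t < 1" "\<forall>i\<in>?I - S. ?q i \<phi> < t"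
        using ne unfolding level_set_def top by blast
      obtain V where "V \<in> \<V>" "w V (\<phi> a) = 1" using one[OF inX[OF \<phi>(1) a]] by blast
      then show ?thesis using \<phi> a by force
    qed
    then obtain v where v: "\<And>a. a \<in> {1..d} \<Longrightarrow> v a \<in> \<V> \<and> (a, v a) \<in> S" by metis
    have "\<exists>U. U \<in> \<U> \<and> v a \<subseteq> U" if "a \<in> {1..d}" for a
      using v[OF that] \<open>refines \<V> \<U>\<close> unfolding refines_def by blast
    then obtain u where u: "\<And>a. a \<in> {1..d} \<Longrightarrow> u a \<in> \<U> \<and> v a \<subseteq> u a" by metis
    have "level_set ?Y ?I ?q S \<subseteq> (\<Pi>\<^sub>E j\<in>{1..d}. u j) \<inter> ?M"
    proof
      fix \<phi> assume "\<phi> \<in> level_set ?Y ?I ?q S"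
      then obtain t where t: "\<phi> \<in> ?M" "0 < t" "\<forall>i\<in>S. t < ?q i \<phi>"
        unfolding level_set_def top by blast
      have "\<phi> a \<in> u a" if a: "a \<in> {1..d}" for a
      proof -
        have "0 < w (v a) (\<phi> a)" using t v[OF a] by force
        then have "\<phi> a \<in> v a" using supp v[OF a] inX[OF t(1) a] by blast
        then show ?thesis using u[OF a] by blast
      qed
      moreover have "\<phi> \<in> extensional {1..d}"
        using t(1) by (auto simp: approx_maps_def PiE_def)
      ultimately show "\<phi> \<in> (\<Pi>\<^sub>E j\<in>{1..d}. u j) \<inter> ?M"
        using t(1) by (auto simp: PiE_def)
    qed
    moreover have "(\<Pi>\<^sub>E j\<in>{1..d}. u j) \<inter> ?M \<in> restrict_cover (power_cover d \<U>) ?M"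
      unfolding restrict_cover_def power_cover_def using u by blast
    ultimately show "\<exists>U\<in>restrict_cover (power_cover d \<U>) ?M. level_set ?Y ?I ?q S \<subseteq> U"
      by blast
  qed
qed

section \<open>Coding a compact metrizable space by reals\<close>

text \<open>The distance to \<open>Z\<close> works, since around a point outside a closed set there
  is a ball missing it. The infimum is meaningless for empty \<open>Z\<close>, where the constant 1
  is used instead.\<close>

lemma closedin_zero_set:
  assumes "metrizable_space X" "closedin X Z"
  obtains f where "continuous_map X euclideanreal f" "\<And>x. x \<in> topspace X \<Longrightarrow> 0 \<le> f x"
    "\<And>x. x \<in> topspace X \<Longrightarrow> f x = 0 \<longleftrightarrow> x \<in> Z"
proof (cases "Z = {}")
  case True
  show ?thesis
    by (rule that[of "\<lambda>_. 1"]) (use True in auto)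
next
  case False
  obtain M d where "Metric_space M d" and X: "X = Metric_space.mtopology M d"
    using assms unfolding metrizable_space_def by blast
  then interpret Metric_space M d by simp
  have ZM: "Z \<subseteq> M"
    using closedin_subset[OF assms(2)] X by simp
  define f where "f = (\<lambda>x. INF z\<in>Z. d x z)"
  have bdd: "bdd_below (d x ` Z)" for x
    by (meson bdd_belowI2 nonneg)
  have tri: "f x \<le> d x y + f y" if "x \<in> M" "y \<in> M" for x y
  proof -
    have "f x - d x y \<le> f y"
      unfolding f_def[THEN fun_cong, of y]
    proof (rule cINF_greatest[OF False])
      fix z assume z: "z \<in> Z"
      have "f x \<le> d x z" unfolding f_def using z bdd by (intro cINF_lower) auto
      also have "\<dots> \<le> d x y + d y z" using that z ZM by (intro triangle) auto
      finally show "f x - d x y \<le> d y z" by simp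
    qed
    then show ?thesis by simp
  qed
  have lip: "\<bar>f x - f y\<bar> \<le> d x y" if "x \<in> M" "y \<in> M" for x y
    using tri[of x y] tri[of y x] that commute[of x y] by linarith
  have "Lipschitz_continuous_map (metric (M,d)) euclidean_metric f"
    unfolding Lipschitz_continuous_map_def
    using lip by (intro conjI exI[of _ 1]) (simp_all add: dist_real_def)
  from Lipschitz_continuous_imp_continuous_map[OF this]
  have cont: "continuous_map X euclideanreal f"
    by (simp add: X)
  have nn: "0 \<le> f x" for x
    unfolding f_def by (rule cINF_greatest[OF False]) simp
  show ?thesis
  proof (rule that[OF cont nn])
    fix x assume "x \<in> topspace X"
    then have x: "x \<in> M" by (simp add: X)
    show "f x = 0 \<longleftrightarrow> x \<in> Z"
    proof
      assume "x \<in> Z"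
      then have "f x \<le> d x x" unfolding f_def using bdd by (intro cINF_lower) auto
      then show "f x = 0" using nn[of x] x by simp
    next
      assume f0: "f x = 0"
      show "x \<in> Z"
      proof (rule ccontr)
        assume "x \<notin> Z"
        then obtain r where r: "r > 0" "mball x r \<subseteq> M - Z"
          using assms(2) x unfolding X closedin_def openin_mtopology by force
        have "z \<notin> mball x r" if "z \<in> Z" for z
          using r(2) that by blast
        then have "r \<le> d x z" if "z \<in> Z" for z
          using that ZM x by (meson in_mball not_le subsetD)
        then have "r \<le> f x" unfolding f_def by (intro cINF_greatest[OF False])
        then show False using f0 r by simp
      qed
    qed
  qed
qed

section \<open>Binary sequences as points of the Cantor set\<close>

text \<open>The standard embedding of the Cantor space into [0,1]: only the ternary digits 0 and 2
  occur, which leaves gaps between points with different digits.\<close>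

definition ternary :: "(nat \<Rightarrow> bool) \<Rightarrow> real" where
  "ternary b = (\<Sum>k. of_bool (b k) * 2 / 3 ^ Suc k)"

lemma ternary_summable: "summable (\<lambda>k. of_bool (b k) * 2 / 3 ^ Suc k :: real)"
proof (rule summable_comparison_test')
  show "summable (\<lambda>k. 2 * (1 / 3) ^ k :: real)"
    by (intro summable_mult summable_geometric) auto
qed (auto simp: power_one_over divide_simps)

lemma ternary_shift: "ternary b = of_bool (b 0) * 2 / 3 + ternary (\<lambda>k. b (Suc k)) / 3"
proof -
  have "ternary b = (\<Sum>k. of_bool (b (Suc k)) * 2 / 3 ^ Suc (Suc k)) + of_bool (b 0) * 2 / 3"
    unfolding ternary_def using suminf_split_head[OF ternary_summable[of b]] by simp
  also have "(\<Sum>k. of_bool (b (Suc k)) * 2 / 3 ^ Suc (Suc k)) = ternary (\<lambda>k. b (Suc k)) / 3"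
    unfolding ternary_def suminf_divide[OF ternary_summable[of "\<lambda>k. b (Suc k)"], symmetric]
    by (simp add: field_simps)
  finally show ?thesis by simp
qed

lemma ternary_bounds: "0 \<le> ternary b" "ternary b \<le> 1"
proof -
  show "0 \<le> ternary b"
    unfolding ternary_def by (intro suminf_nonneg ternary_summable) auto
  have *: "(\<lambda>k. 2 / 3 * (1 / 3) ^ k :: real) sums (2 / 3 * (1 / (1 - 1 / 3)))"
    by (intro sums_mult geometric_sums) auto
  have "ternary b \<le> (\<Sum>k. 2 / 3 * (1 / 3) ^ k)"
    unfolding ternary_def
  proof (rule suminf_le[OF _ ternary_summable])
    show "summable (\<lambda>k. 2 / 3 * (1 / 3) ^ k :: real)" using * sums_summable by blast
  qed (auto simp: power_one_over divide_simps)
  also have "\<dots> = 1" using sums_unique[OF *] by simp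
  finally show "ternary b \<le> 1" .
qed

text \<open>If the first digits differ, they contribute 2/3 to the difference and the tails take
  away at most 1/3, so the points are at least 1/3 apart. Otherwise dropping the first digit
  multiplies the difference by 3, and induction applies.\<close>

lemma ternary_close_imp_agree:
  assumes "\<bar>ternary b - ternary c\<bar> < 1 / 3 ^ N" "k < N"
  shows "b k = c k"
  using assms
proof (induction N arbitrary: b c k)
  case 0 then show ?case by simp
next
  case (Suc N)
  have le: "1 / 3 ^ Suc N \<le> (1 / 3 :: real)"
    by (simp add: divide_simps)
  have *: "ternary b - ternary c = (of_bool (b 0) - of_bool (c 0)) * 2 / 3
      + (ternary (\<lambda>k. b (Suc k)) - ternary (\<lambda>k. c (Suc k))) / 3"
    by (subst (1 2) ternary_shift) (simp add: field_simps)
  have 0: "b 0 = c 0"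
  proof (rule ccontr)
    assume ne: "b 0 \<noteq> c 0"
    have "\<bar>ternary (\<lambda>k. b (Suc k)) - ternary (\<lambda>k. c (Suc k))\<bar> \<le> 1"
      using ternary_bounds[of "\<lambda>k. b (Suc k)"] ternary_bounds[of "\<lambda>k. c (Suc k)"] by linarith
    with ne have "1 / 3 \<le> \<bar>ternary b - ternary c\<bar>"
      unfolding * by (cases "b 0"; cases "c 0") (auto simp: abs_if field_simps split: if_splits)
    then show False using Suc.prems le by linarith
  qed
  show ?case
  proof (cases k)
    case zero: 0
    then show ?thesis using 0 by simp
  next
    case k: (Suc j)
    have "\<bar>ternary (\<lambda>k. b (Suc k)) - ternary (\<lambda>k. c (Suc k))\<bar> < 1 / 3 ^ N"
      using Suc.prems(1) unfolding * by (simp add: 0 field_simps)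
    from Suc.IH[OF this, of j] show ?thesis using k Suc.prems(2) by simp
  qed
qed

section \<open>Coding points by a sequence of balls\<close>

text \<open>The \<open>B k\<close> enumerate the balls of finite covers by balls of radius
  \<open>1 / (n + 1)\<close>, for all \<open>n\<close>. The balls of one such cover appear before
  some index \<open>N\<close>; points with the same membership up to \<open>N\<close> share one of
  these balls and are less than two radii apart.\<close>

lemma compact_metric_separating_sets:
  assumes "Metric_space M d" "compact_space (Metric_space.mtopology M d)" "M \<noteq> {}"
  obtains B :: "nat \<Rightarrow> 'x set"
  where "\<And>e. 0 < e \<Longrightarrow> \<exists>N. \<forall>x\<in>M. \<forall>y\<in>M. (\<forall>k<N. x \<in> B k \<longleftrightarrow> y \<in> B k) \<longrightarrow> d x y < e"
proof -
  interpret Metric_space M d by fact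
  have "mtotally_bounded M"
    using assms(2) compact_space_eq_mcomplete_mtotally_bounded by blast
  then have "\<exists>K. finite K \<and> K \<subseteq> M \<and> M \<subseteq> (\<Union>x\<in>K. mball x (1 / real (Suc n)))" for n
    unfolding mtotally_bounded_def by simp
  then obtain K where K: "\<And>n. finite (K n)" "\<And>n. M \<subseteq> (\<Union>x\<in>K n. mball x (1 / real (Suc n)))"
    by metis
  define \<B> where "\<B> = (\<Union>n. (\<lambda>x. mball x (1 / real (Suc n))) ` K n)"
  have "countable \<B>"
    unfolding \<B>_def using K(1) by (intro countable_UN countable_image) (auto intro: countable_finite)
  moreover have "K 0 \<noteq> {}"
    using K(2)[of 0] assms(3) by auto
  then have "\<B> \<noteq> {}"
    unfolding \<B>_def by auto
  ultimately have range: "range (from_nat_into \<B>) = \<B>"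
    by simp
  show ?thesis
  proof (rule that[of "from_nat_into \<B>"])
    fix e :: real assume "0 < e"
    then obtain n where n: "1 / real (Suc n) < e / 2"
      using nat_approx_posE[of "e/2"] by auto
    let ?C = "(\<lambda>x. mball x (1 / real (Suc n))) ` K n"
    have "finite ?C" "?C \<subseteq> range (from_nat_into \<B>)"
      unfolding range using K(1) by (auto simp: \<B>_def)
    then obtain I where I: "finite I" "?C = from_nat_into \<B> ` I"
      by (metis finite_subset_image)
    obtain N where N: "I \<subseteq> {..<N}"
      using I(1) finite_nat_iff_bounded by blast
    show "\<exists>N. \<forall>x\<in>M. \<forall>y\<in>M. (\<forall>k<N. x \<in> from_nat_into \<B> k \<longleftrightarrow> y \<in> from_nat_into \<B> k) \<longrightarrow> d x y < e"
    proof (intro exI[of _ N] ballI impI)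
      fix x y assume xy: "x \<in> M" "y \<in> M" and same: "\<forall>k<N. x \<in> from_nat_into \<B> k \<longleftrightarrow> y \<in> from_nat_into \<B> k"
      obtain c where c: "c \<in> K n" "x \<in> mball c (1 / real (Suc n))"
        using K(2)[of n] xy by blast
      then have "mball c (1 / real (Suc n)) \<in> from_nat_into \<B> ` I" using I(2) by blast
      then obtain k where "k \<in> I" "mball c (1 / real (Suc n)) = from_nat_into \<B> k" by auto
      then have "y \<in> mball c (1 / real (Suc n))" using same c N by auto
      with c have "d c x < e / 2" "d c y < e / 2" "c \<in> M" using n by auto
      then show "d x y < e" using triangle[of x c y] xy commute[of x c] by linarith
    qed
  qed
qed

text \<open>A section \<open>h\<close>, in general discontinuous, of a continuous surjection from a compact set of
  reals; it transports weak compactness of measures from the line to \<open>X\<close>.\<close>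

lemma compact_metrizable_real_coding:
  fixes X :: "'x topology"
  assumes "compact_space X" "metrizable_space X" "topspace X \<noteq> {}"
  obtains h :: "'x \<Rightarrow> real" and \<pi> :: "real \<Rightarrow> 'x" and K
  where "closed K" "K \<subseteq> {0..1}" "h ` topspace X \<subseteq> K"
    "continuous_map (top_of_set K) X \<pi>" "\<And>x. x \<in> topspace X \<Longrightarrow> \<pi> (h x) = x"
proof -
  obtain M d where "Metric_space M d" and X: "X = Metric_space.mtopology M d"
    using assms unfolding metrizable_space_def by blast
  then interpret Metric_space M d by simp
  have topX: "topspace X = M" by (simp add: X)
  have "compact_space mtopology" "M \<noteq> {}"
    using assms(1,3) unfolding topX unfolding X by auto
  then obtain B :: "nat \<Rightarrow> 'x set" where B:
    "\<And>e. 0 < e \<Longrightarrow> \<exists>N. \<forall>x\<in>M. \<forall>y\<in>M. (\<forall>k<N. x \<in> B k \<longleftrightarrow> y \<in> B k) \<longrightarrow> d x y < e"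
    by (rule compact_metric_separating_sets[OF \<open>Metric_space M d\<close>]) (rule that)
  define h where "h x = ternary (\<lambda>k. x \<in> B k)" for x
  \<comment> \<open>Close codes have many digits in common, so the inverse of \<open>h\<close> is
    uniformly continuous on the image.\<close>
  have h_inv: "\<exists>\<delta>>0. \<forall>x\<in>M. \<forall>y\<in>M. \<bar>h x - h y\<bar> < \<delta> \<longrightarrow> d x y < e" if e: "0 < e" for e
  proof -
    obtain N where "\<forall>x\<in>M. \<forall>y\<in>M. (\<forall>k<N. x \<in> B k \<longleftrightarrow> y \<in> B k) \<longrightarrow> d x y < e"
      using B[OF e] by blast
    then have "\<forall>x\<in>M. \<forall>y\<in>M. \<bar>h x - h y\<bar> < 1 / 3 ^ N \<longrightarrow> d x y < e"
      unfolding h_def using ternary_close_imp_agree by (intro ballI impI) metis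
    then show ?thesis
      by (intro exI[of _ "1 / 3 ^ N"]) simp
  qed
  have "inj_on h M"
  proof (rule inj_onI, rule ccontr)
    fix x y assume xy: "x \<in> M" "y \<in> M" "h x = h y" "x \<noteq> y"
    then have "0 < d x y" by simp
    from h_inv[OF this] show False using xy by force
  qed
  then have inv: "inv_into M h (h x) = x" if "x \<in> M" for x
    using that by simp
  have "uniformly_continuous_map (submetric euclidean_metric (h ` M)) (metric (M,d)) (inv_into M h)"
    unfolding uniformly_continuous_map_def
  proof (intro conjI allI impI)
    fix e :: real assume "0 < e"
    from h_inv[OF this] show "\<exists>\<delta>>0. \<forall>x\<in>mspace (submetric euclidean_metric (h ` M)).
      \<forall>y\<in>mspace (submetric euclidean_metric (h ` M)). mdist (submetric euclidean_metric (h ` M)) y x < \<delta> \<longrightarrow>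
        mdist (metric (M,d)) (inv_into M h y) (inv_into M h x) < e"
      by (auto simp: inv dist_real_def)
  qed (auto simp: inv)
  moreover have "mcomplete_of (metric (M,d))"
    using assms(1) compact_space_eq_mcomplete_mtotally_bounded X by simp
  \<comment> \<open>A compact metric space is complete, so the uniformly continuous inverse of
    \<open>h\<close> extends to the closure of the image, which becomes \<open>K\<close>.\<close>
  ultimately obtain \<pi> where \<pi>: "uniformly_continuous_map
      (submetric euclidean_metric (mtopology_of euclidean_metric closure_of (h ` M))) (metric (M,d)) \<pi>"
    "\<And>r. r \<in> h ` M \<Longrightarrow> \<pi> r = inv_into M h r"
    using uniformly_continuous_map_extends_to_closure_of[of "metric (M,d)" euclidean_metric] by metis
  show ?thesis
  proof (rule that[of "closure (h ` M)" h \<pi>])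
    show "closure (h ` M) \<subseteq> {0..1}"
      by (rule closure_minimal) (auto simp: h_def ternary_bounds)
    show "h ` topspace X \<subseteq> closure (h ` M)"
      unfolding topX by (rule closure_subset)
    show "continuous_map (top_of_set (closure (h ` M))) X \<pi>"
      using uniformly_continuous_imp_continuous_map[OF \<pi>(1)]
      by (simp add: mtopology_of_submetric X)
    show "\<pi> (h x) = x" if "x \<in> topspace X" for x
      using that \<pi>(2) inv topX by auto
  qed simp
qed

section \<open>Weak limits of empirical measures\<close>

lemma space_borel_of [simp]: "space (borel_of X) = topspace X"
  by (simp add: borel_of_def space_measure_of_conv)

lemma sets_borel_of: "sets (borel_of X) = sigma_sets (topspace X) {U. openin X U}"
  unfolding borel_of_def by (intro sets_measure_of) (auto dest: openin_subset)

lemma openin_borel_of: "openin X U \<Longrightarrow> U \<in> sets (borel_of X)"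
  unfolding sets_borel_of by auto

lemma closedin_borel_of:
  assumes "closedin X Z"
  shows "Z \<in> sets (borel_of X)"
proof -
  have "topspace X - (topspace X - Z) \<in> sets (borel_of X)"
    using assms openin_borel_of[of X "topspace X - Z"]
    by (metis closedin_def sets.compl_sets space_borel_of)
  moreover have "topspace X - (topspace X - Z) = Z"
    using closedin_subset[OF assms] by blast
  ultimately show ?thesis by simp
qed

lemma measurable_into_borel_of:
  assumes "f \<in> space M \<rightarrow> topspace X" "\<And>U. openin X U \<Longrightarrow> f -` U \<inter> space M \<in> sets M"
  shows "f \<in> measurable M (borel_of X)"
  unfolding borel_of_def using assms
  by (intro measurable_measure_of) (auto dest: openin_subset)

lemma continuous_map_measurable_borel_of:
  assumes "continuous_map X Y f"
  shows "f \<in> measurable (borel_of X) (borel_of Y)"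
proof (rule measurable_into_borel_of)
  show "f \<in> space (borel_of X) \<rightarrow> topspace Y"
    using assms by (simp add: continuous_map_def)
  show "f -` U \<inter> space (borel_of X) \<in> sets (borel_of X)" if "openin Y U" for U
  proof -
    have "f -` U \<inter> space (borel_of X) = {x \<in> topspace X. f x \<in> U}" by auto
    then show ?thesis
      using openin_borel_of[OF openin_continuous_map_preimage[OF assms that]] by simp
  qed
qed

lemma continuous_map_borel_measurable:
  fixes f :: "'x \<Rightarrow> real"
  assumes "continuous_map X euclideanreal f"
  shows "f \<in> borel_measurable (borel_of X)"
proof (rule borel_measurableI)
  fix S :: "real set" assume "open S"
  then have "openin X {x \<in> topspace X. f x \<in> S}"
    using assms by (intro openin_continuous_map_preimage) auto
  moreover have "f -` S \<inter> space (borel_of X) = {x \<in> topspace X. f x \<in> S}" by auto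
  ultimately show "f -` S \<inter> space (borel_of X) \<in> sets (borel_of X)"
    using openin_borel_of by simp
qed

section \<open>Measures determined by integrals of continuous functions\<close>

lemma compact_space_continuous_real_bounded:
  assumes "compact_space X" "continuous_map X euclideanreal f"
  obtains C where "0 < C" "\<And>x. x \<in> topspace X \<Longrightarrow> \<bar>f x\<bar> \<le> C"
proof -
  have "compactin euclideanreal (f ` topspace X)"
    using assms image_compactin unfolding compact_space_def by blast
  then have "bounded (f ` topspace X)"
    by (simp add: compact_imp_bounded)
  then obtain C where "0 < C" "\<forall>y\<in>f ` topspace X. norm y \<le> C"
    unfolding bounded_pos by blast
  then show ?thesis using that by simp
qed

text \<open>The continuous functions \<open>max 0 (1 - k * f x)\<close> converge pointwise to the
  indicator of the zero set \<open>Z\<close> and are dominated by 1.\<close>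

lemma measure_closed_eq_limit_integrals:
  assumes "prob_space \<mu>" "sets \<mu> = sets (borel_of X)"
    and f: "continuous_map X euclideanreal f" "\<And>x. x \<in> topspace X \<Longrightarrow> 0 \<le> f x"
    and Z: "Z \<in> sets \<mu>" "\<And>x. x \<in> topspace X \<Longrightarrow> f x = 0 \<longleftrightarrow> x \<in> Z"
  shows "(\<lambda>k. \<integral>x. max 0 (1 - real k * f x) \<partial>\<mu>) \<longlonglongrightarrow> measure \<mu> Z"
proof -
  interpret prob_space \<mu> by fact
  have sp: "space \<mu> = topspace X"
    using sets_eq_imp_space_eq[OF assms(2)] by simp
  have fm [measurable]: "f \<in> borel_measurable \<mu>"
    using continuous_map_borel_measurable[OF f(1)] assms(2) measurable_cong_sets by blast
  note Z(1) [measurable]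
  have "(\<lambda>k. \<integral>x. max 0 (1 - real k * f x) \<partial>\<mu>) \<longlonglongrightarrow> (\<integral>x. indicator Z x \<partial>\<mu>)"
  proof (rule integral_dominated_convergence[where w = "\<lambda>_. 1"])
    show "AE x in \<mu>. (\<lambda>k. max 0 (1 - real k * f x)) \<longlonglongrightarrow> indicator Z x"
    proof (rule AE_I2)
      fix x assume "x \<in> space \<mu>"
      then have x: "x \<in> topspace X" by (simp add: sp)
      show "(\<lambda>k. max 0 (1 - real k * f x)) \<longlonglongrightarrow> indicator Z x"
      proof (cases "x \<in> Z")
        case True
        then show ?thesis using Z(2)[OF x] by simp
      next
        case False
        then have pos: "0 < f x" using Z(2)[OF x] f(2)[OF x] by simp
        obtain N where N: "1 / f x \<le> real N" using real_arch_simple by blast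
        have "max 0 (1 - real k * f x) = 0" if "N \<le> k" for k
        proof -
          have "1 / f x \<le> real k" using N that by linarith
          then show ?thesis using pos by (simp add: field_simps)
        qed
        then have "\<forall>\<^sub>F k in sequentially. max 0 (1 - real k * f x) = 0"
          using eventually_sequentially by blast
        then show ?thesis using False by (simp add: tendsto_eventually)
      qed
    qed
    show "AE x in \<mu>. norm (max 0 (1 - real k * f x)) \<le> 1" for k
      by (rule AE_I2) (use f(2) sp in auto)
  qed auto
  moreover have "(\<integral>x. indicator Z x \<partial>\<mu>) = measure \<mu> Z"
    using Z(1) by simp
  ultimately show ?thesis by simp
qed

lemma continuous_map_hat:
  assumes "continuous_map X euclideanreal f"
  shows "continuous_map X euclideanreal (\<lambda>x. max 0 (1 - c * f x))"
  using assms by (intro continuous_map_real_max continuous_map_diff continuous_map_real_mult) auto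

text \<open>Integrals of continuous functions determine the measure of closed sets by the preceding
  limit, hence of open sets by complements; open sets form an intersection-stable generator.\<close>

lemma borel_of_measure_eqI:
  assumes "metrizable_space X"
    and \<mu>: "prob_space \<mu>" "sets \<mu> = sets (borel_of X)"
    and \<nu>: "prob_space \<nu>" "sets \<nu> = sets (borel_of X)"
    and eq: "\<And>f. continuous_map X euclideanreal f \<Longrightarrow> integral\<^sup>L \<mu> f = integral\<^sup>L \<nu> f"
  shows "\<mu> = \<nu>"
proof -
  interpret \<mu>: prob_space \<mu> by fact
  interpret \<nu>: prob_space \<nu> by fact
  have sp: "space \<mu> = topspace X" "space \<nu> = topspace X"
    using sets_eq_imp_space_eq[OF \<mu>(2)] sets_eq_imp_space_eq[OF \<nu>(2)] by auto
  have closed_eq: "measure \<mu> Z = measure \<nu> Z" if Z: "closedin X Z" for Z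
  proof -
    obtain f where f: "continuous_map X euclideanreal f" "\<And>x. x \<in> topspace X \<Longrightarrow> 0 \<le> f x"
      "\<And>x. x \<in> topspace X \<Longrightarrow> f x = 0 \<longleftrightarrow> x \<in> Z"
      by (rule closedin_zero_set[OF assms(1) Z]) (rule that)
    have "(\<lambda>k. \<integral>x. max 0 (1 - real k * f x) \<partial>\<mu>) \<longlonglongrightarrow> measure \<mu> Z"
      using closedin_borel_of[OF Z] f \<mu> by (intro measure_closed_eq_limit_integrals) auto
    moreover have "(\<lambda>k. \<integral>x. max 0 (1 - real k * f x) \<partial>\<nu>) \<longlonglongrightarrow> measure \<nu> Z"
      using closedin_borel_of[OF Z] f \<nu> by (intro measure_closed_eq_limit_integrals) auto
    ultimately show ?thesis
      using eq[OF continuous_map_hat[OF f(1)]] LIMSEQ_unique by simp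
  qed
  show ?thesis
  proof (rule measure_eqI_generator_eq[where E = "{U. openin X U}" and \<Omega> = "topspace X"
        and A = "\<lambda>_. topspace X"])
    show "Int_stable {U. openin X U}" by (auto simp: Int_stable_def)
    show "{U. openin X U} \<subseteq> Pow (topspace X)" by (auto dest: openin_subset)
    show "sets \<mu> = sigma_sets (topspace X) {U. openin X U}"
      "sets \<nu> = sigma_sets (topspace X) {U. openin X U}"
      using \<mu> \<nu> sets_borel_of by auto
    fix U assume "U \<in> {U. openin X U}"
    then have U: "openin X U" by simp
    then have "closedin X (topspace X - U)" by blast
    from closed_eq[OF this] have "measure \<mu> (space \<mu> - U) = measure \<nu> (space \<nu> - U)"
      by (simp add: sp)
    then have "measure \<mu> U = measure \<nu> U"
      using U \<mu> \<nu> openin_borel_of[OF U] by (simp add: \<mu>.prob_compl \<nu>.prob_compl)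
    then show "emeasure \<mu> U = emeasure \<nu> U"
      by (simp add: \<mu>.emeasure_eq_measure \<nu>.emeasure_eq_measure)
  qed auto
qed

section \<open>Compactness of empirical measures\<close>

text \<open>The empirical measures are carried to the line by \<open>h\<close>, a weakly convergent
  subsequence is extracted there, and its limit is brought back to \<open>X\<close> by
  \<open>\<pi>\<close>.\<close>

lemma empirical_measures_weak_limit:
  fixes X :: "'x topology" and \<phi> :: "nat \<Rightarrow> nat \<Rightarrow> 'x"
  assumes X: "compact_space X" "metrizable_space X"
    and m: "\<And>n. 0 < m n" and \<phi>: "\<And>n a. a \<in> {1..m n} \<Longrightarrow> \<phi> n a \<in> topspace X"
  obtains r :: "nat \<Rightarrow> nat" and \<mu> :: "'x measure"
  where "strict_mono r" "prob_space \<mu>" "sets \<mu> = sets (borel_of X)"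
    "\<And>f. continuous_map X euclideanreal f \<Longrightarrow>
       (\<lambda>n. (\<Sum>a\<in>{1..m (r n)}. f (\<phi> (r n) a)) / real (m (r n))) \<longlonglongrightarrow> integral\<^sup>L \<mu> f"
proof -
  have "\<phi> 0 1 \<in> topspace X"
    using m[of 0] by (intro \<phi>) auto
  then obtain x\<^sub>0 where x0: "x\<^sub>0 \<in> topspace X" by blast
  then have "topspace X \<noteq> {}" by blast
  then obtain h :: "'x \<Rightarrow> real" and \<pi> :: "real \<Rightarrow> 'x" and K
    where K: "closed K" "K \<subseteq> {0..1}" "h ` topspace X \<subseteq> K"
    and \<pi>: "continuous_map (top_of_set K) X \<pi>" "\<And>x. x \<in> topspace X \<Longrightarrow> \<pi> (h x) = x"
    by (rule compact_metrizable_real_coding[OF X]) (rule that)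
  \<comment> \<open>The source measure is discrete, so the possible discontinuity of
    \<open>h\<close> causes no measurability problem.\<close>
  define \<nu> where "\<nu> n = distr (measure_pmf (pmf_of_set {1..m n})) borel (\<lambda>a. h (\<phi> n a))" for n
  have ne: "{1..m n} \<noteq> {}" for n
    using m[of n] by simp
  have hK: "h (\<phi> n a) \<in> K" if "a \<in> {1..m n}" for n a
    using \<phi>[OF that] K(3) by blast
  have dist\<nu>: "real_distribution (\<nu> n)" for n
    unfolding \<nu>_def real_distribution_def real_distribution_axioms_def
    by (auto intro!: measure_pmf.prob_space_distr)
  have int\<nu>: "integral\<^sup>L (\<nu> n) g = (\<Sum>a\<in>{1..m n}. g (h (\<phi> n a))) / real (m n)"
    if "g \<in> borel_measurable borel" for n and g :: "real \<Rightarrow> real"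
    unfolding \<nu>_def using that ne[of n]
    by (subst integral_distr) (auto simp: integral_pmf_of_set)
  \<comment> \<open>All mass sits in \<open>K\<close>, inside [0,1]; the slightly larger half-open
    interval has the form that \<open>tight\<close> asks for.\<close>
  have "measure (\<nu> n) {-1<..2} = 1" for n
  proof -
    have "measure (\<nu> n) {-1<..2} = (\<Sum>a\<in>{1..m n}. indicator {-1<..2} (h (\<phi> n a))) / real (m n)"
      using int\<nu>[of "indicator {-1<..2}" n] by (simp add: \<nu>_def)
    also have "(\<Sum>a\<in>{1..m n}. indicator {-1<..2} (h (\<phi> n a)) :: real) = (\<Sum>a\<in>{1..m n}. 1)"
      using hK[of _ n] K(2) by (intro sum.cong) (force simp: indicator_def)+
    finally show ?thesis using m[of n] by simp
  qed
  then have "tight \<nu>"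
    unfolding tight_def using dist\<nu> by (intro conjI allI impI exI[of _ "-1"] exI[of _ 2]) auto
  then obtain r N where r: "strict_mono r" and N: "real_distribution N" "weak_conv_m (\<nu> \<circ> r) N"
    using tight_imp_convergent_subsubsequence[of \<nu> "\<lambda>n. n"] by (auto simp: strict_mono_def o_def)
  interpret N: real_distribution N by fact
  have conv: "(\<lambda>n. (\<Sum>a\<in>{1..m (r n)}. g (h (\<phi> (r n) a))) / real (m (r n))) \<longlonglongrightarrow> integral\<^sup>L N g"
    if g: "continuous_on UNIV g" "\<And>x. \<bar>g x\<bar> \<le> C" for g :: "real \<Rightarrow> real" and C
  proof -
    have "(\<lambda>n. integral\<^sup>L ((\<nu> \<circ> r) n) g) \<longlonglongrightarrow> integral\<^sup>L N g"
      using N g dist\<nu> continuous_on_eq_continuous_at[OF open_UNIV, of g]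
      by (intro weak_conv_imp_integral_bdd_continuous_conv[where B = C]) (auto simp: o_def)
    then show ?thesis
      using int\<nu>[OF borel_measurable_continuous_onI[OF g(1)]] by simp
  qed
  have "K \<noteq> {}" using K(3) x0 by blast
  \<comment> \<open>The bounded continuous function \<open>min 1 (infdist x K)\<close> has integral
    0 against every \<open>\<nu> n\<close>, hence against \<open>N\<close>; as \<open>K\<close> is
    closed, \<open>N\<close> is concentrated on it.\<close>
  have AE_K: "AE x in N. x \<in> K"
  proof -
    let ?g = "\<lambda>x. min 1 (infdist x K)"
    have cont: "continuous_on UNIV ?g" by (intro continuous_intros)
    have bound: "\<bar>?g x\<bar> \<le> 1" for x
      using infdist_nonneg[of x K] by linarith
    have "(\<lambda>n. (\<Sum>a\<in>{1..m (r n)}. ?g (h (\<phi> (r n) a))) / real (m (r n))) \<longlonglongrightarrow> integral\<^sup>L N ?g"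
      by (rule conv[OF cont bound])
    moreover have "(\<Sum>a\<in>{1..m (r n)}. ?g (h (\<phi> (r n) a))) = 0" for n
      using hK[of _ "r n"] by (intro sum.neutral) auto
    ultimately have 0: "integral\<^sup>L N ?g = 0"
      by (simp add: LIMSEQ_const_iff)
    have meas: "?g \<in> borel_measurable N"
      using borel_measurable_continuous_onI[OF cont] by simp
    have "integrable N ?g"
      using meas by (intro N.integrable_const_bound[where B = 1]) (use bound in auto)
    then have "AE x in N. ?g x = 0"
      using 0 by (subst (asm) integral_nonneg_eq_0_iff_AE) (auto simp: infdist_nonneg)
    then show ?thesis
    proof (rule AE_mp[OF _ AE_I2], intro impI)
      fix x assume "min 1 (infdist x K) = 0"
      then have "infdist x K = 0" by (auto simp: min_def split: if_splits)
      then show "x \<in> K" using in_closed_iff_infdist_zero[OF K(1) \<open>K \<noteq> {}\<close>] by blast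
    qed
  qed
  \<comment> \<open>\<open>\<pi>\<close> is controlled only on \<open>K\<close>. The default value
    \<open>x\<^sub>0\<close> makes \<open>p\<close> a measurable map into \<open>X\<close> and is
    taken on a null set of \<open>N\<close>.\<close>
  define p where "p x = (if x \<in> K then \<pi> x else x\<^sub>0)" for x
  have Kb: "K \<in> sets borel" using K(1) by (rule borel_closed)
  have p_meas: "p \<in> measurable N (borel_of X)"
  proof (rule measurable_into_borel_of)
    show "p \<in> space N \<rightarrow> topspace X"
      using \<pi>(1) x0 by (auto simp: p_def continuous_map_def)
    fix U assume U: "openin X U"
    have "openin (top_of_set K) {x \<in> K. \<pi> x \<in> U}"
      using openin_continuous_map_preimage[OF \<pi>(1) U] by simp
    then obtain T where T: "open T" "{x \<in> K. \<pi> x \<in> U} = K \<inter> T"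
      by (metis openin_open)
    have "p -` U \<inter> space N = (K \<inter> T) \<union> (if x\<^sub>0 \<in> U then - K else {})"
      unfolding T(2)[symmetric] p_def by (auto split: if_splits)
    also have "\<dots> \<in> sets N"
      using T(1) Kb by auto
    finally show "p -` U \<inter> space N \<in> sets N" .
  qed
  define \<mu> where "\<mu> = distr N (borel_of X) p"
  show ?thesis
  proof (rule that[OF r])
    show "prob_space \<mu>"
      unfolding \<mu>_def by (rule N.prob_space_distr[OF p_meas])
    show "sets \<mu> = sets (borel_of X)" by (simp add: \<mu>_def)
    fix f assume f: "continuous_map X euclideanreal f"
    obtain C where C: "0 < C" "\<And>x. x \<in> topspace X \<Longrightarrow> \<bar>f x\<bar> \<le> C"
      by (rule compact_space_continuous_real_bounded[OF X(1) f]) (rule that)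
    have "continuous_map (top_of_set K) euclideanreal (f \<circ> \<pi>)"
      using continuous_map_compose[OF \<pi>(1) f] .
    then have "continuous_on K (f \<circ> \<pi>)" by simp
    moreover have "\<pi> x \<in> topspace X" if "x \<in> K" for x
      using \<pi>(1) that by (auto simp: continuous_map_def)
    then have "norm ((f \<circ> \<pi>) x) \<le> C" if "x \<in> K" for x
      using C(2) that by simp
    \<comment> \<open>Weak convergence is tested against bounded continuous functions on the whole
      line, so \<open>f \<circ> \<pi>\<close> is extended from \<open>K\<close> by Tietze.\<close>
    ultimately obtain g where g: "continuous_on UNIV g" "\<And>x. x \<in> K \<Longrightarrow> g x = (f \<circ> \<pi>) x"
      "\<And>x. norm (g x) \<le> C"
      using Tietze[of K "f \<circ> \<pi>" UNIV C] C(1) K(1) by auto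
    have "integral\<^sup>L \<mu> f = (\<integral>x. f (p x) \<partial>N)"
      unfolding \<mu>_def by (rule integral_distr[OF p_meas continuous_map_borel_measurable[OF f]])
    also have "\<dots> = integral\<^sup>L N g"
    proof (rule integral_cong_AE)
      show "(\<lambda>x. f (p x)) \<in> borel_measurable N"
        using measurable_compose[OF p_meas continuous_map_borel_measurable[OF f]] .
      show "g \<in> borel_measurable N"
        using borel_measurable_continuous_onI[OF g(1)] by simp
      show "AE x in N. f (p x) = g x"
        using AE_K by (rule AE_mp) (auto simp: p_def g(2))
    qed
    finally have "integral\<^sup>L N g = integral\<^sup>L \<mu> f" by simp
    moreover have "g (h (\<phi> n a)) = f (\<phi> n a)" if "a \<in> {1..m n}" for n a
      using g(2)[OF hK[OF that]] \<pi>(2) \<phi>[OF that] by simp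
    then have "(\<Sum>a\<in>{1..m (r n)}. g (h (\<phi> (r n) a))) = (\<Sum>a\<in>{1..m (r n)}. f (\<phi> (r n) a))" for n
      by (intro sum.cong) auto
    ultimately show "(\<lambda>n. (\<Sum>a\<in>{1..m (r n)}. f (\<phi> (r n) a)) / real (m (r n))) \<longlonglongrightarrow> integral\<^sup>L \<mu> f"
      using conv[OF g(1), of C] g(3) by simp
  qed
qed

section \<open>Invariance of weak limits\<close>

text \<open>Close points are handled by uniform continuity. At distance at least
  \<open>\<theta>\<close> the trivial bound \<open>2 * C\<close> is absorbed by
  \<open>2 * C / \<theta>\<^sup>2\<close> times the squared distance. The square matches the
  quadratic mean in \<open>dist2\<close>, so that the estimate can be averaged.\<close>

lemma continuous_map_quadratic_modulus:
  assumes "compact_space X" "compatible_metric X \<rho>" "continuous_map X euclideanreal f" "0 < \<eta>"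
  obtains c where "0 \<le> c"
    "\<And>x y. x \<in> topspace X \<Longrightarrow> y \<in> topspace X \<Longrightarrow> \<bar>f x - f y\<bar> \<le> \<eta> + c * (\<rho> x y)\<^sup>2"
proof -
  interpret Metric_space "topspace X" \<rho>
    using assms(2) unfolding compatible_metric_def by blast
  have X: "mtopology = X"
    using assms(2) unfolding compatible_metric_def by blast
  have "uniformly_continuous_map (metric (topspace X, \<rho>)) euclidean_metric f"
    using assms(1,3) X by (intro continuous_imp_uniformly_continuous_map) simp
  then have "\<exists>\<theta>>0. \<forall>x\<in>topspace X. \<forall>y\<in>topspace X. \<rho> y x < \<theta> \<longrightarrow> \<bar>f y - f x\<bar> < \<eta>"
    using \<open>0 < \<eta>\<close> unfolding uniformly_continuous_map_def by (simp add: dist_real_def)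
  then obtain \<theta> where \<theta>: "0 < \<theta>"
    "\<And>x y. x \<in> topspace X \<Longrightarrow> y \<in> topspace X \<Longrightarrow> \<rho> x y < \<theta> \<Longrightarrow> \<bar>f x - f y\<bar> < \<eta>"
    by blast
  obtain C where C: "0 < C" "\<And>x. x \<in> topspace X \<Longrightarrow> \<bar>f x\<bar> \<le> C"
    by (rule compact_space_continuous_real_bounded[OF assms(1,3)]) (rule that)
  show ?thesis
  proof (rule that[of "2 * C / \<theta>\<^sup>2"])
    show "0 \<le> 2 * C / \<theta>\<^sup>2" using C(1) by simp
    fix x y assume xy: "x \<in> topspace X" "y \<in> topspace X"
    show "\<bar>f x - f y\<bar> \<le> \<eta> + 2 * C / \<theta>\<^sup>2 * (\<rho> x y)\<^sup>2"
    proof (cases "\<rho> x y < \<theta>")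
      case True
      have "0 \<le> 2 * C / \<theta>\<^sup>2 * (\<rho> x y)\<^sup>2" using C(1) by simp
      then show ?thesis using \<theta>(2)[OF xy True] by linarith
    next
      case False
      then have "\<theta>\<^sup>2 \<le> (\<rho> x y)\<^sup>2"
        using \<theta>(1) by (intro power_mono) auto
      then have "2 * C * 1 \<le> 2 * C * ((\<rho> x y)\<^sup>2 / \<theta>\<^sup>2)"
        using C(1) \<theta>(1) by (intro mult_left_mono) auto
      moreover have "\<bar>f x - f y\<bar> \<le> 2 * C" using C(2)[OF xy(1)] C(2)[OF xy(2)] by linarith
      ultimately show ?thesis using \<open>0 < \<eta>\<close> by simp
    qed
  qed
qed

text \<open>Reindexing by the permutation \<open>\<sigma> s\<close> leaves the average of
  \<open>f \<circ> \<phi>\<close> unchanged. The terms can then be compared one by one, and the mean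
  of the squared distances is at most \<open>\<delta>\<^sup>2\<close>.\<close>

lemma approx_maps_average_almost_invariant:
  assumes "0 < d" "\<sigma> s permutes {1..d}" "s \<in> F" "\<phi> \<in> approx_maps X \<alpha> \<rho> F \<delta> d \<sigma>" "0 \<le> c"
    and \<alpha>: "\<And>x. x \<in> topspace X \<Longrightarrow> \<alpha> s x \<in> topspace X"
    and f: "\<And>x y. x \<in> topspace X \<Longrightarrow> y \<in> topspace X \<Longrightarrow> \<bar>f x - f y\<bar> \<le> \<eta> + c * (\<rho> x y)\<^sup>2"
  shows "\<bar>(\<Sum>a\<in>{1..d}. f (\<phi> a)) / real d - (\<Sum>a\<in>{1..d}. f (\<alpha> s (\<phi> a))) / real d\<bar> \<le> \<eta> + c * \<delta>\<^sup>2"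
proof -
  have \<phi>X: "\<phi> a \<in> topspace X" if "a \<in> {1..d}" for a
    using assms(4) that by (auto simp: approx_maps_def)
  let ?S = "\<Sum>a\<in>{1..d}. (\<rho> (\<phi> (\<sigma> s a)) (\<alpha> s (\<phi> a)))\<^sup>2"
  have S0: "0 \<le> 1 / real d * ?S"
    by (intro mult_nonneg_nonneg sum_nonneg) auto
  have "sqrt (1 / real d * ?S) \<le> \<delta>"
    using assms(3,4) by (auto simp: approx_maps_def dist2_def)
  then have "(sqrt (1 / real d * ?S))\<^sup>2 \<le> \<delta>\<^sup>2"
    using S0 by (intro power_mono) auto
  then have S: "?S / real d \<le> \<delta>\<^sup>2"
    using S0 by simp
  have "(\<Sum>a\<in>{1..d}. f (\<phi> a)) = (\<Sum>a\<in>{1..d}. f (\<phi> (\<sigma> s a)))"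
    using sum.permute[OF assms(2), of "\<lambda>a. f (\<phi> a)"] by (simp add: o_def)
  then have "\<bar>(\<Sum>a\<in>{1..d}. f (\<phi> a)) - (\<Sum>a\<in>{1..d}. f (\<alpha> s (\<phi> a)))\<bar>
      = \<bar>\<Sum>a\<in>{1..d}. f (\<phi> (\<sigma> s a)) - f (\<alpha> s (\<phi> a))\<bar>"
    by (simp add: sum_subtractf)
  also have "\<dots> \<le> (\<Sum>a\<in>{1..d}. \<bar>f (\<phi> (\<sigma> s a)) - f (\<alpha> s (\<phi> a))\<bar>)"
    by (rule sum_abs)
  also have "\<dots> \<le> (\<Sum>a\<in>{1..d}. \<eta> + c * (\<rho> (\<phi> (\<sigma> s a)) (\<alpha> s (\<phi> a)))\<^sup>2)"
  proof (rule sum_mono)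
    fix a assume a: "a \<in> {1..d}"
    then have "\<sigma> s a \<in> {1..d}" using permutes_in_image[OF assms(2)] by blast
    then show "\<bar>f (\<phi> (\<sigma> s a)) - f (\<alpha> s (\<phi> a))\<bar> \<le> \<eta> + c * (\<rho> (\<phi> (\<sigma> s a)) (\<alpha> s (\<phi> a)))\<^sup>2"
      using \<phi>X a \<alpha> by (intro f) auto
  qed
  also have "\<dots> = real d * \<eta> + c * ?S"
    by (simp add: sum.distrib sum_distrib_left)
  finally have "\<bar>(\<Sum>a\<in>{1..d}. f (\<phi> a)) - (\<Sum>a\<in>{1..d}. f (\<alpha> s (\<phi> a)))\<bar> / real d \<le> (real d * \<eta> + c * ?S) / real d"
    by (rule divide_right_mono) simp
  also have "\<dots> = \<eta> + c * (?S / real d)"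
    using assms(1) by (simp add: field_simps)
  also have "\<dots> \<le> \<eta> + c * \<delta>\<^sup>2"
    using mult_left_mono[OF S assms(5)] by simp
  finally show ?thesis
    by (simp add: diff_divide_distrib[symmetric] abs_divide)
qed

lemma approx_maps_mono:
  assumes "F' \<subseteq> F" "\<delta> \<le> \<delta>'"
  shows "approx_maps X \<alpha> \<rho> F \<delta> d \<sigma> \<subseteq> approx_maps X \<alpha> \<rho> F' \<delta>' d \<sigma>"
  using assms unfolding approx_maps_def by fastforce

text \<open>For each \<open>\<eta>\<close> the averages of \<open>f\<close> and of
  \<open>f \<circ> \<alpha> g\<close> eventually differ by at most
  \<open>\<eta> + c * (\<delta> n)\<^sup>2\<close>, where \<open>c\<close> does not depend on
  \<open>n\<close>. Hence the limiting integrals differ by at most \<open>\<eta>\<close>.\<close>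

lemma weak_limit_invariant:
  assumes X: "compact_space X" "metrizable_space X" and "compatible_metric X \<rho>"
    and \<alpha>: "continuous_map X X (\<alpha> g)"
    and m: "\<And>n. 0 < m n" and perm: "\<And>n. \<sigma> n g permutes {1..m n}"
    and \<phi>: "\<And>n. \<phi> n \<in> approx_maps X \<alpha> \<rho> (F n) (\<delta> n) (m n) (\<sigma> n)"
    and "\<forall>\<^sub>F n in sequentially. g \<in> F n" and \<delta>: "\<delta> \<longlonglongrightarrow> 0"
    and \<mu>: "prob_space \<mu>" "sets \<mu> = sets (borel_of X)"
    and lim: "\<And>f. continuous_map X euclideanreal f \<Longrightarrow>
       (\<lambda>n. (\<Sum>a\<in>{1..m n}. f (\<phi> n a)) / real (m n)) \<longlonglongrightarrow> integral\<^sup>L \<mu> f"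
  shows "distr \<mu> (borel_of X) (\<alpha> g) = \<mu>"
proof -
  interpret prob_space \<mu> by fact
  have meas: "\<alpha> g \<in> measurable \<mu> (borel_of X)"
    using continuous_map_measurable_borel_of[OF \<alpha>] \<mu>(2) measurable_cong_sets by blast
  have \<alpha>X: "\<alpha> g x \<in> topspace X" if "x \<in> topspace X" for x
    using \<alpha> that by (auto simp: continuous_map_def)
  show ?thesis
  proof (rule borel_of_measure_eqI[OF X(2) prob_space_distr[OF meas] _ \<mu>])
    fix f assume f: "continuous_map X euclideanreal f"
    have f\<alpha>: "continuous_map X euclideanreal (\<lambda>x. f (\<alpha> g x))"
      using continuous_map_compose[OF \<alpha> f] by (simp add: o_def)
    have diff: "(\<lambda>n. \<bar>(\<Sum>a\<in>{1..m n}. f (\<phi> n a)) / real (m n)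
        - (\<Sum>a\<in>{1..m n}. f (\<alpha> g (\<phi> n a))) / real (m n)\<bar>)
        \<longlonglongrightarrow> \<bar>integral\<^sup>L \<mu> f - (\<integral>x. f (\<alpha> g x) \<partial>\<mu>)\<bar>"
      by (intro tendsto_rabs tendsto_diff lim f f\<alpha>)
    have "\<bar>integral\<^sup>L \<mu> f - (\<integral>x. f (\<alpha> g x) \<partial>\<mu>)\<bar> \<le> \<eta>" if "0 < \<eta>" for \<eta>
    proof -
      obtain c where c: "0 \<le> c"
        "\<And>x y. x \<in> topspace X \<Longrightarrow> y \<in> topspace X \<Longrightarrow> \<bar>f x - f y\<bar> \<le> \<eta> + c * (\<rho> x y)\<^sup>2"
        by (rule continuous_map_quadratic_modulus[OF X(1) assms(3) f \<open>0 < \<eta>\<close>]) (rule that)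
      have "(\<lambda>n. \<eta> + c * (\<delta> n)\<^sup>2) \<longlonglongrightarrow> \<eta> + c * 0\<^sup>2"
        by (intro tendsto_intros \<delta>)
      then have "(\<lambda>n. \<eta> + c * (\<delta> n)\<^sup>2) \<longlonglongrightarrow> \<eta>" by simp
      moreover have "\<forall>\<^sub>F n in sequentially. \<bar>(\<Sum>a\<in>{1..m n}. f (\<phi> n a)) / real (m n)
        - (\<Sum>a\<in>{1..m n}. f (\<alpha> g (\<phi> n a))) / real (m n)\<bar> \<le> \<eta> + c * (\<delta> n)\<^sup>2"
        using assms(8)
      proof (rule eventually_mono)
        fix n assume "g \<in> F n"
        then show "\<bar>(\<Sum>a\<in>{1..m n}. f (\<phi> n a)) / real (m n)
          - (\<Sum>a\<in>{1..m n}. f (\<alpha> g (\<phi> n a))) / real (m n)\<bar> \<le> \<eta> + c * (\<delta> n)\<^sup>2"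
          using m perm \<phi> c \<alpha>X by (intro approx_maps_average_almost_invariant) auto
      qed
      ultimately show ?thesis
        using diff by (intro tendsto_le[OF sequentially_bot])
    qed
    then have "\<bar>integral\<^sup>L \<mu> f - (\<integral>x. f (\<alpha> g x) \<partial>\<mu>)\<bar> \<le> 0"
      by (metis field_le_epsilon add_0)
    then show "integral\<^sup>L (distr \<mu> (borel_of X) (\<alpha> g)) f = integral\<^sup>L \<mu> f"
      by (simp add: integral_distr[OF meas continuous_map_borel_measurable[OF f]])
  qed simp
qed

section \<open>Mass of the limit on a closed set\<close>

text \<open>For fixed \<open>k\<close> the function \<open>max 0 (1 - k * p x)\<close> is at least
  \<open>1 - k * \<theta> n\<close> at each counted point, so its averages have limit at least
  \<open>\<epsilon>\<close>. The limit in \<open>n\<close> is taken first, the limit in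
  \<open>k\<close> afterwards.\<close>

lemma weak_limit_closed_ge:
  assumes "metrizable_space X" and m: "\<And>n. 0 < m n"
    and p: "continuous_map X euclideanreal p" "\<And>x. x \<in> topspace X \<Longrightarrow> 0 \<le> p x"
      "\<And>x. x \<in> topspace X \<Longrightarrow> p x = 0 \<longleftrightarrow> x \<in> Z"
    and "closedin X Z" and \<theta>: "\<theta> \<longlonglongrightarrow> 0" and "0 \<le> \<epsilon>"
    and visits: "\<And>n. \<epsilon> * real (m n) \<le> real (card {a\<in>{1..m n}. p (\<phi> n a) \<le> \<theta> n})"
    and \<mu>: "prob_space \<mu>" "sets \<mu> = sets (borel_of X)"
    and lim: "\<And>f. continuous_map X euclideanreal f \<Longrightarrow>
       (\<lambda>n. (\<Sum>a\<in>{1..m n}. f (\<phi> n a)) / real (m n)) \<longlonglongrightarrow> integral\<^sup>L \<mu> f"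
  shows "\<epsilon> \<le> measure \<mu> Z"
proof (rule LIMSEQ_le_const)
  show "(\<lambda>k. \<integral>x. max 0 (1 - real k * p x) \<partial>\<mu>) \<longlonglongrightarrow> measure \<mu> Z"
    using closedin_borel_of[OF assms(6)] \<mu> p by (intro measure_closed_eq_limit_integrals) auto
  have "\<epsilon> \<le> (\<integral>x. max 0 (1 - real k * p x) \<partial>\<mu>)" for k
  proof (rule LIMSEQ_le)
    have "(\<lambda>n. \<epsilon> * (1 - real k * \<theta> n)) \<longlonglongrightarrow> \<epsilon> * (1 - real k * 0)"
      by (intro tendsto_intros \<theta>)
    then show "(\<lambda>n. \<epsilon> * (1 - real k * \<theta> n)) \<longlonglongrightarrow> \<epsilon>" by simp
    show "(\<lambda>n. (\<Sum>a\<in>{1..m n}. max 0 (1 - real k * p (\<phi> n a))) / real (m n))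
      \<longlonglongrightarrow> (\<integral>x. max 0 (1 - real k * p x) \<partial>\<mu>)"
      by (rule lim[OF continuous_map_hat[OF p(1)]])
    have "\<epsilon> * (1 - real k * \<theta> n) \<le> (\<Sum>a\<in>{1..m n}. max 0 (1 - real k * p (\<phi> n a))) / real (m n)" for n
    proof -
      let ?A = "{a\<in>{1..m n}. p (\<phi> n a) \<le> \<theta> n}"
      \<comment> \<open>The factor \<open>1 - k * \<theta> n\<close> may be negative for small
        \<open>n\<close>; passing to its positive part allows multiplication by the cardinality
        bound.\<close>
      have "\<epsilon> * real (m n) * (1 - real k * \<theta> n) \<le> \<epsilon> * real (m n) * max 0 (1 - real k * \<theta> n)"
        using \<open>0 \<le> \<epsilon>\<close> by (intro mult_left_mono) auto
      also have "\<dots> \<le> real (card ?A) * max 0 (1 - real k * \<theta> n)"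
        using visits[of n] by (intro mult_right_mono) auto
      also have "\<dots> = (\<Sum>a\<in>?A. max 0 (1 - real k * \<theta> n))"
        by simp
      also have "\<dots> \<le> (\<Sum>a\<in>?A. max 0 (1 - real k * p (\<phi> n a)))"
        by (intro sum_mono max.mono diff_left_mono mult_left_mono) auto
      also have "\<dots> \<le> (\<Sum>a\<in>{1..m n}. max 0 (1 - real k * p (\<phi> n a)))"
        by (intro sum_mono2) auto
      finally show ?thesis
        using m[of n] by (simp add: field_simps)
    qed
    then show "\<exists>N. \<forall>n\<ge>N. \<epsilon> * (1 - real k * \<theta> n) \<le> (\<Sum>a\<in>{1..m n}. max 0 (1 - real k * p (\<phi> n a))) / real (m n)"
      by blast
  qed
  then show "\<exists>N. \<forall>k\<ge>N. \<epsilon> \<le> (\<integral>x. max 0 (1 - real k * p x) \<partial>\<mu>)"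
    by blast
qed

section \<open>Small boundaries\<close>

text \<open>Otherwise counterexamples exist for finite sets exhausting the group and tolerances
  tending to 0, and a weak limit of their empirical measures is invariant with mass at least
  \<open>\<epsilon>\<close> on \<open>Z\<close>. Since \<open>F\<close>, \<open>\<delta>\<close> and
  \<open>\<theta>\<close> are chosen before \<open>d\<close> and \<open>\<sigma>\<close>, the bound
  is uniform along a sofic approximation.\<close>

lemma small_set_rarely_visited:
  fixes G :: "('g, 'm) monoid_scheme" and X :: "'x topology"
  assumes "group G" "countable (carrier G)" and X: "compact_space X" "metrizable_space X"
    and "continuous_action G X \<alpha>" and \<rho>: "compatible_metric X \<rho>"
    and small: "small_set G X \<alpha> Z"
    and p: "continuous_map X euclideanreal p" "\<And>x. x \<in> topspace X \<Longrightarrow> 0 \<le> p x"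
      "\<And>x. x \<in> topspace X \<Longrightarrow> p x = 0 \<longleftrightarrow> x \<in> Z"
    and "0 < \<epsilon>"
  shows "\<exists>F \<delta> \<theta>. finite F \<and> F \<noteq> {} \<and> F \<subseteq> carrier G \<and> 0 < \<delta> \<and> 0 < \<theta> \<and>
    (\<forall>d \<sigma> \<phi>. 0 < d \<longrightarrow> (\<forall>s\<in>carrier G. \<sigma> s permutes {1..d}) \<longrightarrow>
      \<phi> \<in> approx_maps X \<alpha> \<rho> F \<delta> d \<sigma> \<longrightarrow>
      real (card {a\<in>{1..d}. p (\<phi> a) \<le> \<theta>}) \<le> \<epsilon> * real d)" (is ?goal)
proof (rule ccontr)
  assume contra: "\<not> ?goal"
  have ne: "carrier G \<noteq> {}"
    using monoid.one_closed[OF group.is_monoid[OF assms(1)]] by auto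
  define F where "F n = from_nat_into (carrier G) ` {..n}" for n
  define \<delta> where "\<delta> n = 1 / real (Suc n)" for n
  have F: "finite (F n)" "F n \<noteq> {}" "F n \<subseteq> carrier G" for n
    unfolding F_def using from_nat_into[OF ne] by auto
  have \<delta>_pos: "0 < \<delta> n" for n by (simp add: \<delta>_def)
  \<comment> \<open>The single sequence \<open>\<delta> n\<close> serves both as the equivariance
    tolerance and as the width \<open>\<theta>\<close>.\<close>
  define bad where "bad n d \<sigma> \<phi> \<longleftrightarrow> 0 < d \<and> (\<forall>s\<in>carrier G. \<sigma> s permutes {1..d}) \<and>
      \<phi> \<in> approx_maps X \<alpha> \<rho> (F n) (\<delta> n) d \<sigma> \<and>
      \<epsilon> * real d < real (card {a\<in>{1..d}. p (\<phi> a) \<le> \<delta> n})" for n d \<sigma> \<phi>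
  have "\<exists>d \<sigma> \<phi>. bad n d \<sigma> \<phi>" for n
  proof (rule ccontr)
    assume none: "\<not> (\<exists>d \<sigma> \<phi>. bad n d \<sigma> \<phi>)"
    have "real (card {a\<in>{1..d}. p (\<phi> a) \<le> \<delta> n}) \<le> \<epsilon> * real d"
      if "0 < d" "\<forall>s\<in>carrier G. \<sigma> s permutes {1..d}" "\<phi> \<in> approx_maps X \<alpha> \<rho> (F n) (\<delta> n) d \<sigma>" for d \<sigma> \<phi>
    proof (rule ccontr)
      assume "\<not> ?thesis"
      then have "bad n d \<sigma> \<phi>" unfolding bad_def using that by simp
      then show False using none by blast
    qed
    then have ?goal
      using F[of n] \<delta>_pos[of n]
      by (intro exI[of _ "F n"] exI[of _ "\<delta> n"] conjI allI impI) simp_all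
    with contra show False ..
  qed
  then obtain m \<sigma> \<phi> where bad: "\<And>n. bad n (m n) (\<sigma> n) (\<phi> n)"
    by metis
  then have m: "\<And>n. 0 < m n" and \<sigma>: "\<And>n s. s \<in> carrier G \<Longrightarrow> \<sigma> n s permutes {1..m n}"
    and \<phi>: "\<And>n. \<phi> n \<in> approx_maps X \<alpha> \<rho> (F n) (\<delta> n) (m n) (\<sigma> n)"
    and visits: "\<And>n. \<epsilon> * real (m n) \<le> real (card {a\<in>{1..m n}. p (\<phi> n a) \<le> \<delta> n})"
    unfolding bad_def by (simp_all add: less_imp_le)
  have "\<phi> n a \<in> topspace X" if "a \<in> {1..m n}" for n a
    using \<phi>[of n] that by (auto simp: approx_maps_def)
  from m this obtain r \<mu> where r: "strict_mono r" and \<mu>: "prob_space \<mu>" "sets \<mu> = sets (borel_of X)"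
    and lim: "\<And>f. continuous_map X euclideanreal f \<Longrightarrow>
       (\<lambda>n. (\<Sum>a\<in>{1..m (r n)}. f (\<phi> (r n) a)) / real (m (r n))) \<longlonglongrightarrow> integral\<^sup>L \<mu> f"
    by (rule empirical_measures_weak_limit[OF X]) (assumption, rule that)
  have "\<delta> \<longlonglongrightarrow> 0"
    unfolding \<delta>_def using LIMSEQ_inverse_real_of_nat by (simp add: inverse_eq_divide)
  then have \<delta>r: "(\<lambda>n. \<delta> (r n)) \<longlonglongrightarrow> 0"
    using LIMSEQ_subseq_LIMSEQ[OF _ r] by (simp add: o_def)
  have "distr \<mu> (borel_of X) (\<alpha> g) = \<mu>" if g: "g \<in> carrier G" for g
  proof (rule weak_limit_invariant[OF X \<rho>, where m = "\<lambda>n. m (r n)" and \<sigma> = "\<lambda>n. \<sigma> (r n)"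
        and \<phi> = "\<lambda>n. \<phi> (r n)" and F = "\<lambda>n. F (r n)" and \<delta> = "\<lambda>n. \<delta> (r n)"])
    show "continuous_map X X (\<alpha> g)"
      using assms(5) g unfolding continuous_action_def by blast
    obtain k where k: "g = from_nat_into (carrier G) k"
      using from_nat_into_surj[OF assms(2) g] by metis
    \<comment> \<open>The sets \<open>F n\<close> increase and a strictly increasing
      \<open>r\<close> satisfies \<open>n \<le> r n\<close>.\<close>
    have "g \<in> F (r n)" if "k \<le> n" for n
      using that seq_suble[OF r, of n] unfolding F_def k by (intro imageI) simp
    then show "\<forall>\<^sub>F n in sequentially. g \<in> F (r n)"
      using eventually_sequentially by blast
  qed (use m \<sigma>[OF g] \<phi> \<delta>r \<mu> lim in auto)
  then have "\<mu> \<in> invariant_measures G X \<alpha>"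
    using \<mu> unfolding invariant_measures_def by blast
  then have "emeasure \<mu> Z = 0"
    using small unfolding small_set_def by blast
  then have "measure \<mu> Z = 0"
    by (simp add: measure_def)
  moreover have "\<epsilon> \<le> measure \<mu> Z"
  proof (rule weak_limit_closed_ge[OF X(2), where m = "\<lambda>n. m (r n)" and \<phi> = "\<lambda>n. \<phi> (r n)"
        and \<theta> = "\<lambda>n. \<delta> (r n)" and p = p])
    show "closedin X Z" using small unfolding small_set_def by blast
  qed (use m p \<delta>r visits \<mu> lim \<open>0 < \<epsilon>\<close> in auto)
  ultimately show False using \<open>0 < \<epsilon>\<close> by simp
qed

section \<open>Covers with small boundaries and their weight functions\<close>

lemma small_boundary_refinement:
  assumes "compact_space X" "small_boundary_property G X \<alpha>" "finite_open_cover X \<U>"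
  obtains \<V> where "finite_open_cover X \<V>" "refines \<V> \<U>"
    "\<forall>V\<in>\<V>. small_set G X \<alpha> (X frontier_of V)"
proof -
  let ?\<W> = "{V. openin X V \<and> (\<exists>U\<in>\<U>. V \<subseteq> U) \<and> small_set G X \<alpha> (X frontier_of V)}"
  have "topspace X \<subseteq> \<Union>?\<W>"
  proof
    fix x assume x: "x \<in> topspace X"
    then obtain U where U: "U \<in> \<U>" "openin X U" "x \<in> U"
      using assms(3) unfolding finite_open_cover_def by blast
    then have "U \<subseteq> topspace X" "x \<in> X interior_of U"
      using openin_subset[OF U(2)] interior_of_openin[OF U(2)] by auto
    then obtain V where "openin X V" "x \<in> V" "V \<subseteq> U" "small_set G X \<alpha> (X frontier_of V)"
      using assms(2) x unfolding small_boundary_property_def by meson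
    then show "x \<in> \<Union>?\<W>" using U by blast
  qed
  then obtain \<V> where \<V>: "finite \<V>" "\<V> \<subseteq> ?\<W>" "topspace X \<subseteq> \<Union>\<V>"
    using compactinD[of X "topspace X" ?\<W>] assms(1) unfolding compact_space_def by blast
  have open_V: "openin X V" if "V \<in> \<V>" for V
    using \<V>(2) that by blast
  show ?thesis
  proof (rule that[of \<V>])
    show "finite_open_cover X \<V>"
      unfolding finite_open_cover_def
    proof (intro conjI ballI)
      show "\<Union>\<V> = topspace X"
        using \<V>(3) open_V openin_subset by blast
    qed (use \<V>(1) open_V in auto)
    show "refines \<V> \<U>" using \<V>(2) unfolding refines_def by blast
    show "\<forall>V\<in>\<V>. small_set G X \<alpha> (X frontier_of V)"
      using \<V>(2) by blast
  qed
qed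

text \<open>The open sets on which some \<open>f i\<close> exceeds \<open>1 / (k + 1)\<close> cover
  \<open>X\<close>; finitely many suffice, and any \<open>N\<close> above their indices gives the
  constant.\<close>

lemma uniform_lower_bound_on_cover:
  fixes f :: "'i \<Rightarrow> 'x \<Rightarrow> real"
  assumes "compact_space X" "\<And>i. i \<in> I \<Longrightarrow> continuous_map X euclideanreal (f i)"
    and "\<And>x. x \<in> topspace X \<Longrightarrow> \<exists>i\<in>I. 0 < f i x"
  obtains c where "0 < c" "\<And>x. x \<in> topspace X \<Longrightarrow> \<exists>i\<in>I. c \<le> f i x"
proof -
  define O' where "O' k = (\<Union>i\<in>I. {x \<in> topspace X. 1 / real (Suc k) < f i x})" for k
  have "openin X {x \<in> topspace X. 1 / real (Suc k) < f i x}" if "i \<in> I" for i k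
    using openin_continuous_map_preimage[OF assms(2)[OF that], of "{1 / real (Suc k)<..}"] by simp
  then have "openin X (O' k)" for k
    unfolding O'_def by (intro openin_Union) auto
  then have "\<forall>U\<in>range O'. openin X U" by blast
  moreover have "topspace X \<subseteq> \<Union>(range O')"
  proof
    fix x assume x: "x \<in> topspace X"
    then obtain i where i: "i \<in> I" "0 < f i x" using assms(3) by blast
    then obtain k where "1 / real (Suc k) < f i x" using nat_approx_posE by blast
    then have "x \<in> O' k" using x i unfolding O'_def by blast
    then show "x \<in> \<Union>(range O')" by blast
  qed
  ultimately obtain \<F> where \<F>: "finite \<F>" "\<F> \<subseteq> range O'" "topspace X \<subseteq> \<Union>\<F>"
    using compactinD[of X "topspace X" "range O'"] assms(1) unfolding compact_space_def by blast
  obtain K where K: "finite K" "\<F> = O' ` K"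
    using finite_subset_image[OF \<F>(1,2)] by blast
  obtain N where N: "K \<subseteq> {..<N}"
    using K(1) finite_nat_iff_bounded by blast
  show ?thesis
  proof (rule that[of "1 / real (Suc N)"])
    fix x assume "x \<in> topspace X"
    then obtain k where "k \<in> K" "x \<in> O' k" using \<F>(3) K(2) by blast
    then obtain i where i: "i \<in> I" "1 / real (Suc k) < f i x" unfolding O'_def by blast
    have "1 / real (Suc N) \<le> 1 / real (Suc k)"
      using N \<open>k \<in> K\<close> by (intro divide_left_mono) auto
    then show "\<exists>i\<in>I. 1 / real (Suc N) \<le> f i x" using i by (intro bexI[of _ i]) auto
  qed simp
qed

lemma sofic_dim_at_le:
  assumes "\<forall>\<^sub>F i in sequentially. real_of_int (approx_dim X \<alpha> \<U> \<rho> F \<delta> (d i) (\<sigma> i)) / real (d i) \<le> c"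
    and "0 \<le> c"
  shows "sofic_dim_at X \<alpha> d \<sigma> \<U> \<rho> F \<delta> \<le> ereal c"
proof -
  have "limsup (\<lambda>i. ereal (real_of_int (approx_dim X \<alpha> \<U> \<rho> F \<delta> (d i) (\<sigma> i)) / real (d i))) \<le> ereal c"
    using assms(1) by (intro Limsup_bounded) simp
  then show ?thesis
    unfolding sofic_dim_at_def by simp
qed

text \<open>Each \<open>V\<close> has at most \<open>\<epsilon> * d\<close> coordinates with weight
  strictly between 0 and 1, because these coordinates lie near the boundary of \<open>V\<close>;
  summing over \<open>V\<close> gives the factor \<open>card \<V>\<close>.\<close>

lemma small_boundary_cover_approx_dim_bound:
  fixes G :: "('g, 'm) monoid_scheme" and X :: "'x topology"
  assumes "group G" "countable (carrier G)" and X: "compact_space X" "metrizable_space X"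
    and "continuous_action G X \<alpha>" and \<rho>: "compatible_metric X \<rho>"
    and \<V>: "finite_open_cover X \<V>" "refines \<V> \<U>"
      "\<forall>V\<in>\<V>. small_set G X \<alpha> (X frontier_of V)"
    and "0 < \<epsilon>"
  shows "\<exists>F \<delta>. finite F \<and> F \<noteq> {} \<and> F \<subseteq> carrier G \<and> 0 < \<delta> \<and>
    (\<forall>d \<sigma>. 0 < d \<longrightarrow> (\<forall>s\<in>carrier G. \<sigma> s permutes {1..d}) \<longrightarrow>
      real_of_int (approx_dim X \<alpha> \<U> \<rho> F \<delta> d \<sigma>) \<le> real (card \<V>) * \<epsilon> * real d)"
proof -
  have fin: "finite \<V>" and op: "\<And>V. V \<in> \<V> \<Longrightarrow> openin X V" and cov: "\<Union>\<V> = topspace X"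
    using \<V>(1) unfolding finite_open_cover_def by auto
  have "\<exists>f. continuous_map X euclideanreal f \<and> (\<forall>x\<in>topspace X. 0 \<le> f x) \<and>
      (\<forall>x\<in>topspace X. f x = 0 \<longleftrightarrow> x \<notin> V)" if V: "V \<in> \<V>" for V
  proof -
    have "closedin X (topspace X - V)" using op[OF V] by blast
    from closedin_zero_set[OF X(2) this] obtain f where "continuous_map X euclideanreal f"
      "\<And>x. x \<in> topspace X \<Longrightarrow> 0 \<le> f x" "\<And>x. x \<in> topspace X \<Longrightarrow> f x = 0 \<longleftrightarrow> x \<in> topspace X - V"
      by metis
    then show ?thesis by (intro exI[of _ f]) auto
  qed
  then obtain f where f: "\<And>V. V \<in> \<V> \<Longrightarrow> continuous_map X euclideanreal (f V)"
    "\<And>V x. V \<in> \<V> \<Longrightarrow> x \<in> topspace X \<Longrightarrow> 0 \<le> f V x"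
    "\<And>V x. V \<in> \<V> \<Longrightarrow> x \<in> topspace X \<Longrightarrow> f V x = 0 \<longleftrightarrow> x \<notin> V"
    by metis
  \<comment> \<open>\<open>f V\<close> vanishes exactly off \<open>V\<close>, so the points counted
    lie in a thin collar of the boundary on the inner side of \<open>V\<close>.\<close>
  define rare where "rare V F \<delta> \<theta> \<longleftrightarrow>
    (\<forall>d \<sigma> \<phi>. 0 < d \<longrightarrow> (\<forall>s\<in>carrier G. \<sigma> s permutes {1..d}) \<longrightarrow>
      \<phi> \<in> approx_maps X \<alpha> \<rho> F \<delta> d \<sigma> \<longrightarrow>
      real (card {a\<in>{1..d}. 0 < f V (\<phi> a) \<and> f V (\<phi> a) \<le> \<theta>}) \<le> \<epsilon> * real d)" for V F \<delta> \<theta>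
  have "\<exists>F \<delta> \<theta>. finite F \<and> F \<noteq> {} \<and> F \<subseteq> carrier G \<and> 0 < \<delta> \<and> 0 < \<theta> \<and> rare V F \<delta> \<theta>"
    if V: "V \<in> \<V>" for V
  proof -
    have "closedin X (X closure_of V)" by simp
    then obtain e where e: "continuous_map X euclideanreal e" "\<And>x. x \<in> topspace X \<Longrightarrow> 0 \<le> e x"
      "\<And>x. x \<in> topspace X \<Longrightarrow> e x = 0 \<longleftrightarrow> x \<in> X closure_of V"
      by (rule closedin_zero_set[OF X(2)]) (rule that)
    \<comment> \<open>The zero set of \<open>f V + e\<close> is the boundary of \<open>V\<close>, and \<open>e\<close> vanishes where \<open>f V\<close> is positive.\<close>
    have "f V x + e x = 0 \<longleftrightarrow> x \<in> X frontier_of V" if x: "x \<in> topspace X" for x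
    proof -
      have "f V x + e x = 0 \<longleftrightarrow> f V x = 0 \<and> e x = 0"
        using f(2)[OF V x] e(2)[OF x] by linarith
      then show ?thesis
        using f(3)[OF V x] e(3)[OF x] interior_of_openin[OF op[OF V]] by (simp add: frontier_of_def conj_commute)
    qed
    moreover have "continuous_map X euclideanreal (\<lambda>x. f V x + e x)"
      using f(1)[OF V] e(1) by (intro continuous_map_add)
    moreover have "0 \<le> f V x + e x" if "x \<in> topspace X" for x
      using f(2)[OF V that] e(2)[OF that] by simp
    ultimately have "\<exists>F \<delta> \<theta>. finite F \<and> F \<noteq> {} \<and> F \<subseteq> carrier G \<and> 0 < \<delta> \<and> 0 < \<theta> \<and>
    (\<forall>d \<sigma> \<phi>. 0 < d \<longrightarrow> (\<forall>s\<in>carrier G. \<sigma> s permutes {1..d}) \<longrightarrow>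
      \<phi> \<in> approx_maps X \<alpha> \<rho> F \<delta> d \<sigma> \<longrightarrow>
      real (card {a\<in>{1..d}. f V (\<phi> a) + e (\<phi> a) \<le> \<theta>}) \<le> \<epsilon> * real d)"
      using assms(1-6) bspec[OF \<V>(3) V] \<open>0 < \<epsilon>\<close> by (intro small_set_rarely_visited) auto
    then obtain F \<delta> \<theta> where F: "finite F" "F \<noteq> {}" "F \<subseteq> carrier G" and pos: "0 < \<delta>" "0 < \<theta>"
      and le: "\<forall>d \<sigma> \<phi>. 0 < d \<longrightarrow> (\<forall>s\<in>carrier G. \<sigma> s permutes {1..d}) \<longrightarrow>
      \<phi> \<in> approx_maps X \<alpha> \<rho> F \<delta> d \<sigma> \<longrightarrow>
      real (card {a\<in>{1..d}. f V (\<phi> a) + e (\<phi> a) \<le> \<theta>}) \<le> \<epsilon> * real d"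
      by (elim exE conjE) (rule that)
    show ?thesis
      unfolding rare_def
    proof (rule exI[of _ F], rule exI[of _ \<delta>], rule exI[of _ \<theta>], intro conjI allI impI)
      fix d :: nat and \<sigma> \<phi>
      assume d: "0 < d" "\<forall>s\<in>carrier G. \<sigma> s permutes {1..d}" and \<phi>: "\<phi> \<in> approx_maps X \<alpha> \<rho> F \<delta> d \<sigma>"
      have "f V (\<phi> a) + e (\<phi> a) \<le> \<theta>"
        if a: "a \<in> {1..d}" "0 < f V (\<phi> a)" "f V (\<phi> a) \<le> \<theta>" for a
      proof -
        have x: "\<phi> a \<in> topspace X" using \<phi> a(1) by (auto simp: approx_maps_def)
        then have "\<phi> a \<in> V" using f(3)[OF V x] a(2) by simp
        then have "e (\<phi> a) = 0"
          using e(3)[OF x] closure_of_subset[OF openin_subset[OF op[OF V]]] by blast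
        then show ?thesis using a(3) by simp
      qed
      then have "card {a\<in>{1..d}. 0 < f V (\<phi> a) \<and> f V (\<phi> a) \<le> \<theta>} \<le> card {a\<in>{1..d}. f V (\<phi> a) + e (\<phi> a) \<le> \<theta>}"
        by (intro card_mono) auto
      moreover have "real (card {a\<in>{1..d}. f V (\<phi> a) + e (\<phi> a) \<le> \<theta>}) \<le> \<epsilon> * real d"
        using le d \<phi> by blast
      ultimately show "real (card {a\<in>{1..d}. 0 < f V (\<phi> a) \<and> f V (\<phi> a) \<le> \<theta>}) \<le> \<epsilon> * real d"
        by linarith
    qed (use F pos in auto)
  qed
  then obtain F \<delta> \<theta> where F: "\<And>V. V \<in> \<V> \<Longrightarrow> finite (F V) \<and> F V \<noteq> {} \<and> F V \<subseteq> carrier G"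
    and pos: "\<And>V. V \<in> \<V> \<Longrightarrow> 0 < \<delta> V" "\<And>V. V \<in> \<V> \<Longrightarrow> 0 < \<theta> V"
    and rare: "\<And>V. V \<in> \<V> \<Longrightarrow> rare V (F V) (\<delta> V) (\<theta> V)"
    by metis
  have "\<exists>V\<in>\<V>. 0 < f V x" if x: "x \<in> topspace X" for x
  proof -
    obtain V where V: "V \<in> \<V>" "x \<in> V" using cov x by blast
    then have "0 < f V x" using f(2,3)[OF V(1) x] by simp
    then show ?thesis using V(1) by blast
  qed
  from X(1) f(1) this obtain c where c: "0 < c" "\<And>x. x \<in> topspace X \<Longrightarrow> \<exists>V\<in>\<V>. c \<le> f V x"
    by (rule uniform_lower_bound_on_cover) (assumption, assumption, rule that)
  \<comment> \<open>The choices for the separate \<open>V\<close> are merged using monotonicity of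
    \<open>approx_maps\<close>. The inserted unit, and the inserted 1 in the next line, keep the
    data admissible when \<open>\<V>\<close> is empty.\<close>
  define F\<^sub>0 where "F\<^sub>0 = insert \<one>\<^bsub>G\<^esub> (\<Union>V\<in>\<V>. F V)"
  define \<delta>\<^sub>0 where "\<delta>\<^sub>0 = Min (insert 1 (\<delta> ` \<V>))"
  \<comment> \<open>\<open>b \<le> c\<close> makes some weight equal to 1 at every point;
    \<open>b \<le> \<theta> V\<close> puts the intermediate weights of \<open>V\<close> inside the
    collar counted by \<open>rare\<close>.\<close>
  define b where "b = Min (insert c (\<theta> ` \<V>))"
  have b: "0 < b" "b \<le> c" "\<And>V. V \<in> \<V> \<Longrightarrow> b \<le> \<theta> V"
    unfolding b_def using fin c(1) pos by auto
  \<comment> \<open>Truncation at height \<open>b\<close>: the weight is 0 exactly off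
    \<open>V\<close> and is 1 once \<open>f V\<close> reaches \<open>b\<close>.\<close>
  define w where "w V x = min 1 (f V x / b)" for V x
  have bound: "real_of_int (approx_dim X \<alpha> \<U> \<rho> F\<^sub>0 \<delta>\<^sub>0 d \<sigma>) \<le> real (card \<V>) * \<epsilon> * real d"
    if d: "0 < d" "\<forall>s\<in>carrier G. \<sigma> s permutes {1..d}" for d \<sigma>
  proof -
    define N where "N = nat \<lfloor>real (card \<V>) * \<epsilon> * real d\<rfloor>"
    have N0: "0 \<le> real (card \<V>) * \<epsilon> * real d" using \<open>0 < \<epsilon>\<close> by simp
    have "approx_dim X \<alpha> \<U> \<rho> F\<^sub>0 \<delta>\<^sub>0 d \<sigma> \<le> int N"
    proof (rule approx_dim_le_intermediate_count[OF fin \<V>(2), where w = w])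
      show "continuous_map X euclideanreal (w V)" if "V \<in> \<V>" for V
        unfolding w_def using f(1)[OF that] b(1)
        by (intro continuous_map_real_min continuous_map_real_divide) auto
      show "w V x \<le> 1" for V x by (simp add: w_def)
      show "x \<in> V" if "V \<in> \<V>" "x \<in> topspace X" "0 < w V x" for V x
        using f(3)[OF that(1,2)] that(3) by (cases "x \<in> V") (auto simp: w_def)
      show "\<exists>V\<in>\<V>. w V x = 1" if x: "x \<in> topspace X" for x
      proof -
        obtain V where V: "V \<in> \<V>" "c \<le> f V x" using c(2)[OF x] by blast
        then have "1 \<le> f V x / b" using b by (simp add: le_divide_eq)
        then show ?thesis using V(1) unfolding w_def by (intro bexI[of _ V]) auto
      qed
      fix \<phi> assume \<phi>: "\<phi> \<in> approx_maps X \<alpha> \<rho> F\<^sub>0 \<delta>\<^sub>0 d \<sigma>"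
      let ?A = "\<lambda>V. {a\<in>{1..d}. 0 < w V (\<phi> a) \<and> w V (\<phi> a) < 1}"
      have A: "real (card (?A V)) \<le> \<epsilon> * real d" if V: "V \<in> \<V>" for V
      proof -
        have "\<phi> \<in> approx_maps X \<alpha> \<rho> (F V) (\<delta> V) d \<sigma>"
          using \<phi> V fin approx_maps_mono[of "F V" F\<^sub>0 \<delta>\<^sub>0 "\<delta> V" X \<alpha> \<rho> d \<sigma>]
          by (auto simp: F\<^sub>0_def \<delta>\<^sub>0_def)
        then have "real (card {a\<in>{1..d}. 0 < f V (\<phi> a) \<and> f V (\<phi> a) \<le> \<theta> V}) \<le> \<epsilon> * real d"
          using rare[OF V] d unfolding rare_def by blast
        moreover have "?A V \<subseteq> {a\<in>{1..d}. 0 < f V (\<phi> a) \<and> f V (\<phi> a) \<le> \<theta> V}"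
        proof (intro subsetI CollectI conjI)
          fix a assume a: "a \<in> ?A V"
          then show "a \<in> {1..d}" by blast
          have "0 < f V (\<phi> a) / b" "f V (\<phi> a) / b < 1" using a by (auto simp: w_def)
          then show "0 < f V (\<phi> a)" "f V (\<phi> a) \<le> \<theta> V"
            using b(1) b(3)[OF V] by (simp_all add: zero_less_divide_iff divide_less_eq)
        qed
        then have "card (?A V) \<le> card {a\<in>{1..d}. 0 < f V (\<phi> a) \<and> f V (\<phi> a) \<le> \<theta> V}"
          by (intro card_mono) auto
        ultimately show ?thesis by linarith
      qed
      have "{(a, V). a \<in> {1..d} \<and> V \<in> \<V> \<and> 0 < w V (\<phi> a) \<and> w V (\<phi> a) < 1}
          = prod.swap ` (SIGMA V:\<V>. ?A V)" by force
      then have "card {(a, V). a \<in> {1..d} \<and> V \<in> \<V> \<and> 0 < w V (\<phi> a) \<and> w V (\<phi> a) < 1}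
          = (\<Sum>V\<in>\<V>. card (?A V))"
        using fin by (simp add: card_image card_SigmaI)
      also have "real \<dots> \<le> (\<Sum>V\<in>\<V>. \<epsilon> * real d)"
        unfolding of_nat_sum by (rule sum_mono[OF A])
      finally have "real (card {(a, V). a \<in> {1..d} \<and> V \<in> \<V> \<and> 0 < w V (\<phi> a) \<and> w V (\<phi> a) < 1})
          \<le> real (card \<V>) * \<epsilon> * real d" by simp
      then show "card {(a, V). a \<in> {1..d} \<and> V \<in> \<V> \<and> 0 < w V (\<phi> a) \<and> w V (\<phi> a) < 1} \<le> N"
        unfolding N_def by (simp add: le_nat_floor)
    qed
    then have "real_of_int (approx_dim X \<alpha> \<U> \<rho> F\<^sub>0 \<delta>\<^sub>0 d \<sigma>) \<le> real N"
      by linarith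
    also have "\<dots> \<le> real (card \<V>) * \<epsilon> * real d"
      unfolding N_def using N0 by (rule of_nat_floor)
    finally show ?thesis .
  qed
  show ?thesis
  proof (intro exI[of _ F\<^sub>0] exI[of _ \<delta>\<^sub>0] conjI allI impI)
    show "finite F\<^sub>0" unfolding F\<^sub>0_def using fin F by auto
    show "F\<^sub>0 \<noteq> {}" unfolding F\<^sub>0_def by simp
    show "F\<^sub>0 \<subseteq> carrier G"
      unfolding F\<^sub>0_def using F monoid.one_closed[OF group.is_monoid[OF assms(1)]] by auto
    show "0 < \<delta>\<^sub>0" unfolding \<delta>\<^sub>0_def using fin pos(1) by simp
  qed (rule bound)
qed

section \<open>From uniform bounds to the supremum over all covers\<close>

theorem theorem8p2:
  fixes G :: "('g, 'm) monoid_scheme"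
    and X :: "'x topology"
    and \<alpha> :: "'g \<Rightarrow> 'x \<Rightarrow> 'x"
    and \<rho> :: "'x \<Rightarrow> 'x \<Rightarrow> real"
    and d :: "nat \<Rightarrow> nat"
    and \<sigma> :: "nat \<Rightarrow> 'g \<Rightarrow> nat \<Rightarrow> nat"
  assumes "group G" and "countable (carrier G)" and "sofic_group G"
    and "compact_space X" and "metrizable_space X"
    and "continuous_action G X \<alpha>"
    and "small_boundary_property G X \<alpha>"
    and "sofic_approximation G d \<sigma>"
    and "compatible_metric X \<rho>"
  shows "sofic_mdim G X \<alpha> d \<sigma> \<rho> \<le> 0"
  unfolding sofic_mdim_def
proof (rule SUP_least)
  fix \<U> assume "\<U> \<in> {\<U>. finite_open_cover X \<U>}"
  then have "finite_open_cover X \<U>" by simp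
  then obtain \<V> where \<V>: "finite_open_cover X \<V>" "refines \<V> \<U>"
    "\<forall>V\<in>\<V>. small_set G X \<alpha> (X frontier_of V)"
    by (rule small_boundary_refinement[OF assms(4,7)]) (rule that)
  have perm: "\<forall>s\<in>carrier G. \<sigma> i s permutes {1..d i}" for i
    using assms(8) unfolding sofic_approximation_def by blast
  have "filterlim d at_top sequentially"
    using assms(8) unfolding sofic_approximation_def by blast
  then have "\<forall>\<^sub>F i in sequentially. 1 \<le> d i"
    unfolding filterlim_at_top by blast
  \<comment> \<open>Indices with \<open>d i = 0\<close> must be excluded before dividing; the upper
    limit ignores finitely many of them.\<close>
  then have d_pos: "\<forall>\<^sub>F i in sequentially. 0 < d i"
    by (rule eventually_mono) simp
  have le: "sofic_dim G X \<alpha> d \<sigma> \<rho> \<U> \<le> ereal (real (card \<V>) * \<epsilon>)" if "0 < \<epsilon>" for \<epsilon>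
  proof -
    obtain F \<delta> where F: "finite F" "F \<noteq> {}" "F \<subseteq> carrier G" and \<delta>: "0 < \<delta>"
      and bound: "\<forall>d \<sigma>. 0 < d \<longrightarrow> (\<forall>s\<in>carrier G. \<sigma> s permutes {1..d}) \<longrightarrow>
        real_of_int (approx_dim X \<alpha> \<U> \<rho> F \<delta> d \<sigma>) \<le> real (card \<V>) * \<epsilon> * real d"
      using small_boundary_cover_approx_dim_bound[OF assms(1,2,4,5,6,9) \<V> \<open>0 < \<epsilon>\<close>]
      by (elim exE conjE) (rule that)
    have "\<forall>\<^sub>F i in sequentially.
        real_of_int (approx_dim X \<alpha> \<U> \<rho> F \<delta> (d i) (\<sigma> i)) / real (d i) \<le> real (card \<V>) * \<epsilon>"
      using d_pos by (rule eventually_mono) (use bound perm in \<open>simp add: divide_le_eq\<close>)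
    then have at: "sofic_dim_at X \<alpha> d \<sigma> \<U> \<rho> F \<delta> \<le> ereal (real (card \<V>) * \<epsilon>)"
      using \<open>0 < \<epsilon>\<close> by (intro sofic_dim_at_le) auto
    show ?thesis
      unfolding sofic_dim_def
      by (rule INF_lower2[of F], use F in simp, rule INF_lower2[of \<delta>], use \<delta> in simp, rule at)
  qed
  show "sofic_dim G X \<alpha> d \<sigma> \<rho> \<U> \<le> 0"
  proof (rule ereal_le_epsilon2)
    fix e :: real assume e: "0 < e"
    \<comment> \<open>The cover \<open>\<V>\<close> depends only on \<open>\<U>\<close>, so its size
      is fixed while \<open>e\<close> shrinks. The summand 1 in the denominator allows for an empty
      \<open>\<V>\<close>.\<close>
    have "sofic_dim G X \<alpha> d \<sigma> \<rho> \<U> \<le> ereal (real (card \<V>) * (e / (1 + real (card \<V>))))"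
      using e by (intro le) simp
    also have "\<dots> \<le> 0 + ereal e"
      using e by (simp add: field_simps)
    finally show "sofic_dim G X \<alpha> d \<sigma> \<rho> \<U> \<le> 0 + ereal e" .
  qed
qed

end
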